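(* Let $(x,\varepsilon,1,y)$ be an extended normal extremal tuple with switch points $\{b_j\}_{j\in\mathbb Z}$, fix $j$, and let $\epsilon=\varepsilon(b_j+0)$ be the value of $\varepsilon(\cdot)$ in the layer $I=(b_j,b_{j+1})$. Assume $$x[I]\subset\mathrm{Sec}_6\cup\mathbb R_+\cup\mathrm{Sec}_1\cup\mathrm{Sec}_3\cup\mathbb R_-\cup\mathrm{Sec}_4.$$ Then: (i) If $x(b_j)\in\mathbb C_+$, then $x(b_{j+1})\in\mathbb C_-$ and $b_{j+1}-b_j<\frac{\pi}{2\epsilon^{1/2}\operatorname{Re}\kappa}$. (ii) If $x(b_j)\in\mathbb C_-$, then $x(b_{j+1})\in\mathbb C_+$ and $\frac{\pi}{2\epsilon^{1/2}\operatorname{Re}\kappa}<b_{j+1}-b_j<\frac{\pi}{\epsilon^{1/2}\operatorname{Re}\kappa}$.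
   Context: Fix constants $0<n_1<n_2$ and $\kappa\in\mathbb C$ with $\operatorname{Re}\kappa>0$, $\operatorname{Im}\kappa<0$; $\operatorname{Arg}_0\kappa\in(-\pi/2,0)$ is its principal argument. $\hat{\mathbb C}=\mathbb C\cup\{\infty\}$, $\mathbb C_\pm=\{z:\pm\operatorname{Im}z>0\}$, $\mathbb R_\pm=\{s\in\mathbb R:\pm s>0\}$. For a function $y$ put $\mathcal E(y)(s)=n_1^2+(n_2^2-n_1^2)\chi_{\mathbb C_+}(y^2(s))$. Let $y\in W^{2,\infty}_{\mathrm{loc}}(\mathbb R)$ be a nontrivial complex-valued solution on $\mathbb R$ of $-y''=\kappa^2\,y\,\mathcal E(y)$, let $\varepsilon=\mathcal E(y)$ and $x=\frac{y'}{\mathrm i\kappa y}$ ($x(s)=\infty$ where $y(s)=0$). The quantity $\operatorname{Im}(\varepsilon(s)y^2(s)+\kappa^{-2}(y'(s))^2)$ is a constant $\lambda_0$ independent of $s$. If $\lambda_0\ge0$, then $(x,\varepsilon,\lambda_0,y)$ is called an extended extremal tuple; it is normal if $\lambda_0>0$, and here it is normalized so that $\lambda_0=1$. The function $\varepsilon$ (after correction on a null set) is piecewise constant on bounded intervals with values $n_1^2,n_2^2$; a switch point is a point $b$ with $\varepsilon(b-0)\ne\varepsilon(b+0)$. The switch points form a strictly increasing sequence $\{b_j\}_{j\in\mathbb Z}$ with $\lim_{j\to\pm\infty}b_j=\pm\infty$. The intervals $(b_j,b_{j+1})$ are called layers; $x[I]=\{x(s):s\in I\}$. For $\xi_1<\xi_2$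 let $\mathrm{Sec}(\xi_1,\xi_2)=\{ce^{\mathrm i\xi}:c>0,\ \xi\in(\xi_1,\xi_2)\}$. Put $\mathrm{Sec}_1=\mathrm{Sec}(0,\pi/2)$, $\mathrm{Sec}_3=\mathrm{Sec}(\pi/2-\operatorname{Arg}_0\kappa,\pi)$, $\mathrm{Sec}_4=\mathrm{Sec}(\pi,3\pi/2)$, $\mathrm{Sec}_6=\mathrm{Sec}(3\pi/2-\operatorname{Arg}_0\kappa,2\pi)$. *)

theory Defs
  imports "HOL-Analysis.Analysis"
begin

definition Linf_loc :: "(real \<Rightarrow> complex) \<Rightarrow> bool" where
  "Linf_loc g \<longleftrightarrow> g \<in> borel_measurable lebesgue \<and>
     (\<forall>a b. \<exists>C. AE s in lebesgue. s \<in> {a..b} \<longrightarrow> norm (g s) \<le> C)"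

abbreviation deriv1 :: "(real \<Rightarrow> complex) \<Rightarrow> real \<Rightarrow> complex" where
  "deriv1 y s \<equiv> vector_derivative y (at s)"

text \<open>Functions of class \<open>W\<close> with indices \<open>2,\<infinity>\<close>, locally on the line, are identified with their
  continuously differentiable representatives: \<open>y'\<close> exists everywhere and is an indefinite integral
  of a locally essentially bounded function, which is the weak second derivative.\<close>

definition W2inf_loc :: "(real \<Rightarrow> complex) \<Rightarrow> bool" where
  "W2inf_loc y \<longleftrightarrow> (\<forall>s. y differentiable (at s)) \<and>
     (\<exists>g. Linf_loc g \<and>
        (\<forall>a b. a \<le> b \<longrightarrow> (g has_integral (deriv1 y b - deriv1 y a)) {a..b}))"

definition C_plus :: "complex set" where "C_plus = {z. Im z > 0}"

definition C_minus :: "complex set" where "C_minus = {z. Im z < 0}"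

definition R_plus :: "complex set" where "R_plus = complex_of_real ` {0<..}"

definition R_minus :: "complex set" where "R_minus = complex_of_real ` {..<0}"

definition permittivity :: "real \<Rightarrow> real \<Rightarrow> (real \<Rightarrow> complex) \<Rightarrow> real \<Rightarrow> real" where
  "permittivity n1 n2 y s = n1\<^sup>2 + (n2\<^sup>2 - n1\<^sup>2) * indicator C_plus ((y s)\<^sup>2)"

text \<open>For a function of the above class \<open>y'\<close> is differentiable almost everywhere and its pointwise
  derivative is the weak second derivative, so the equation is imposed almost everywhere.\<close>

definition solves_nonlinear_eq ::
    "real \<Rightarrow> real \<Rightarrow> complex \<Rightarrow> (real \<Rightarrow> complex) \<Rightarrow> bool" where
  "solves_nonlinear_eq n1 n2 \<kappa> y \<longleftrightarrow> W2inf_loc y \<and>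
     (AE s in lebesgue.
        (deriv1 y has_vector_derivative - (\<kappa>\<^sup>2 * y s * of_real (permittivity n1 n2 y s))) (at s))"

text \<open>The extended complex plane is \<^typ>\<open>complex option\<close>, with \<^term>\<open>None\<close> as the point at
  infinity.\<close>

definition log_deriv_x :: "complex \<Rightarrow> (real \<Rightarrow> complex) \<Rightarrow> real \<Rightarrow> complex option" where
  "log_deriv_x \<kappa> y s = (if y s = 0 then None else Some (deriv1 y s / (\<i> * \<kappa> * y s)))"

definition extended_extremal_tuple ::
    "real \<Rightarrow> real \<Rightarrow> complex \<Rightarrow> (real \<Rightarrow> complex option) \<Rightarrow> (real \<Rightarrow> real) \<Rightarrow> real \<Rightarrow>
     (real \<Rightarrow> complex) \<Rightarrow> bool" where
  "extended_extremal_tuple n1 n2 \<kappa> x \<epsilon> \<Lambda> y \<longleftrightarrow>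
     solves_nonlinear_eq n1 n2 \<kappa> y \<and> (\<exists>s. y s \<noteq> 0) \<and>
     \<epsilon> = permittivity n1 n2 y \<and> x = log_deriv_x \<kappa> y \<and>
     (\<forall>s. Im (of_real (\<epsilon> s) * (y s)\<^sup>2 + (deriv1 y s)\<^sup>2 / \<kappa>\<^sup>2) = \<Lambda>) \<and> 0 \<le> \<Lambda>"

text \<open>One-sided limits at a point do not see the values of \<open>\<epsilon>\<close> at isolated points. For the
  \<open>\<epsilon>\<close> of a normal tuple, the correction on a null set that makes it piecewise constant only changes
  such values, so no corrected version is needed here.\<close>

definition switch_point :: "(real \<Rightarrow> real) \<Rightarrow> real \<Rightarrow> bool" where
  "switch_point \<epsilon> b \<longleftrightarrow>
     (\<exists>l r. (\<epsilon> \<longlongrightarrow> l) (at_left b) \<and> (\<epsilon> \<longlongrightarrow> r) (at_right b) \<and> l \<noteq> r)"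

definition switch_sequence :: "(real \<Rightarrow> real) \<Rightarrow> (int \<Rightarrow> real) \<Rightarrow> bool" where
  "switch_sequence \<epsilon> b \<longleftrightarrow> strict_mono b \<and> range b = {s. switch_point \<epsilon> s} \<and>
     filterlim b at_top at_top \<and> filterlim b at_bot at_bot"

definition Sec :: "real \<Rightarrow> real \<Rightarrow> complex set" where
  "Sec \<xi>1 \<xi>2 = {of_real c * exp (\<i> * of_real \<xi>) | c \<xi>. c > 0 \<and> \<xi>1 < \<xi> \<and> \<xi> < \<xi>2}"

definition Sec1 :: "complex set" where
  "Sec1 = Sec 0 (pi / 2)"

definition Sec3 :: "complex \<Rightarrow> complex set" where
  "Sec3 \<kappa> = Sec (pi / 2 - Arg \<kappa>) pi"

definition Sec4 :: "complex set" where
  "Sec4 = Sec pi (3 * pi / 2)"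

definition Sec6 :: "complex \<Rightarrow> complex set" where
  "Sec6 \<kappa> = Sec (3 * pi / 2 - Arg \<kappa>) (2 * pi)"

end

theory Submission
  imports Defs
begin

text \<open>
  Inside the layer \<open>\<epsilon>\<close> is the constant \<open>e\<close>, so \<open>y\<close> solves \<open>y'' = - k\<^sup>2 y\<close> with
  \<open>k = \<surd>e \<kappa>\<close>. Conservation excludes the pure exponentials, hence \<open>y = D sin \<zeta>\<close> where
  \<open>\<zeta> = p + i q\<close> runs along a straight line with velocity \<open>k\<close>, and \<open>x = - i \<surd>e cot \<zeta>\<close>
  (lemma \<open>sin_solution_on_constant_piece\<close>). Up to positive factors \<open>Im x\<close> is \<open>- sin 2p\<close> and \<open>Re x\<close>
  is \<open>- q\<close>, so the half planes in the claim are conditions on \<open>p\<close>, and the length of the layer is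
  the increment of \<open>p\<close> divided by \<open>\<surd>e Re \<kappa>\<close>. It has to be shown that this increment is below
  \<open>\<pi>\<close>, and on which side of \<open>\<pi>/2\<close> it lies.

  The increment is read off from the two ends of the layer. At a switch point \<open>y\<^sup>2\<close> is real and,
  less obviously, nonzero (\<open>switch_point_nonzero\<close>). Conversely a point with \<open>y \<noteq> 0\<close> at which
  \<open>y\<^sup>2\<close> is real and \<open>Im (y'/y) = Re (\<kappa> x)\<close> does not vanish is a switch point
  (\<open>transversal_imp_switch_point\<close>). The sectors in the hypothesis avoid the line
  \<open>Re (\<kappa> x) = 0\<close>, and in them \<open>Re (\<kappa> x)\<close> has the sign of \<open>Re x\<close>, that is of \<open>- q\<close>. Therefore
  in the open layer \<open>y\<^sup>2\<close> stays off the real line while \<open>arg y\<close> moves monotonically, and from one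
  end to the other \<open>y\<close> turns by exactly a quarter turn: the ratio \<open>r = y / y(b\<^sub>j)\<close> stays in one
  closed quadrant adjacent to \<open>1\<close> and ends on the imaginary axis (\<open>real_endpoints_quarter_turn\<close>).

  For \<open>q < 0\<close> the rest is trigonometry of \<open>sin \<zeta>\<^sub>1 = i \<tau> sin \<zeta>\<^sub>0\<close> with \<open>\<tau> > 0\<close>. As
  \<open>cosh > \<bar>sinh\<bar>\<close>, the angle of \<open>i sin \<zeta>\<close> is closer than \<open>p\<close> to the nearest odd multiple of
  \<open>\<pi>/2\<close>. While \<open>i sin \<zeta>\<close> turns by \<open>\<pi>/2\<close>, the real part \<open>p\<close> therefore advances by less than \<open>\<pi>/2\<close>
  when it crosses a multiple of \<open>\<pi>\<close>, which is how \<open>x\<close> passes from the upper to the lower half plane,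
  and by more than \<open>\<pi>/2\<close> when it crosses an odd multiple of \<open>\<pi>/2\<close>
  (\<open>sin_path_quarter_turn\<close>). For \<open>q > 0\<close> one conjugates.
\<close>

section \<open>Lipschitz functions and their almost everywhere derivative\<close>

text \<open>The fundamental theorem of calculus for Lipschitz functions that are differentiable off a null
  set. In a Riemann sum the intervals with tag off \<open>N\<close> are handled as for a function differentiable
  everywhere; those with tag in \<open>N\<close> contribute at most the Lipschitz constant times their total
  length, which a gauge makes small because the indicator of \<open>N\<close> has integral \<open>0\<close>.\<close>

lemma lipschitz_AE_derivative_has_integral:
  fixes f :: "real \<Rightarrow> 'a::banach"
  assumes ab: "a \<le> b" and N: "negligible N"
    and lip: "\<And>u v. a \<le> u \<Longrightarrow> u \<le> v \<Longrightarrow> v \<le> b \<Longrightarrow> norm (f v - f u) \<le> C * (v - u)"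
    and der: "\<And>x. x \<in> {a..b} - N \<Longrightarrow> (f has_vector_derivative f' x) (at x within {a..b})"
  shows "(f' has_integral (f b - f a)) {a..b}"
proof -
  define h where "h x = (if x \<in> N then 0 else f' x)" for x
  have "(h has_integral (f b - f a)) {a..b}"
    unfolding has_integral_real
  proof (intro allI impI)
    fix e :: real assume e: "e > 0"
    \<comment> \<open>The summand \<open>1\<close> covers the degenerate interval \<open>a = b\<close>.\<close>
    define c where "c = e / (2 * (b - a + 1))"
    have c: "c > 0" "c * (b - a) < e / 2"
      using ab e by (auto simp: c_def field_simps)
    define M where "M = \<bar>C\<bar> + 1"
    have M: "M > 0" by (simp add: M_def)
    have lipM: "norm (f v - f u) \<le> M * (v - u)" if "a \<le> u" "u \<le> v" "v \<le> b" for u v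
      using lip[OF that] mult_right_mono[of C M "v - u"] that unfolding M_def by linarith
    have "\<forall>x. \<exists>d>0. x \<in> {a..b} - N \<longrightarrow>
         (\<forall>y\<in>{a..b}. norm (y-x) < d \<longrightarrow> norm (f y - f x - (y-x) *\<^sub>R f' x) \<le> c * norm (y-x))"
      using der[unfolded has_vector_derivative_def has_derivative_within_alt] c(1)
      by (metis zero_less_one)
    then obtain d where d: "\<And>x. 0 < d x"
                 "\<And>x y. \<lbrakk>x \<in> {a..b} - N; y \<in> {a..b}; norm (y-x) < d x\<rbrakk>
                        \<Longrightarrow> norm (f y - f x - (y-x) *\<^sub>R f' x) \<le> c * norm (y-x)"
      by metis
    have "(indicat_real N has_integral 0) {a..b}"
      using N negligible by blast
    then obtain \<gamma> where \<gamma>: "gauge \<gamma>" and \<gamma>_sum: "\<And>p. p tagged_division_of {a..b} \<Longrightarrow> \<gamma> fine p \<Longrightarrow>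
        norm ((\<Sum>(x,K)\<in>p. measure lborel K *\<^sub>R indicat_real N x) - 0) < e / (2 * M)"
      unfolding has_integral_real using e M by (metis divide_pos_pos mult_pos_pos zero_less_numeral)
    show "\<exists>\<gamma>. gauge \<gamma> \<and> (\<forall>p. p tagged_division_of {a..b} \<and> \<gamma> fine p \<longrightarrow>
            norm ((\<Sum>(x,K)\<in>p. measure lborel K *\<^sub>R h x) - (f b - f a)) < e)"
    proof (intro exI conjI allI impI; (elim conjE)?)
      show "gauge (\<lambda>x. ball x (d x) \<inter> \<gamma> x)"
        using d(1) \<gamma> by (intro gauge_Int gauge_ball_dependent) auto
    next
      fix p assume p: "p tagged_division_of {a..b}" and "(\<lambda>x. ball x (d x) \<inter> \<gamma> x) fine p"
      then have fd: "(\<lambda>x. ball x (d x)) fine p" and fg: "\<gamma> fine p"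
        by (simp_all add: fine_Int)
      have *: "norm (measure lborel K *\<^sub>R h x - (f (Sup K) - f (Inf K)))
              \<le> c * (Sup K - Inf K) + M * (measure lborel K *\<^sub>R indicat_real N x)"
        if xK: "(x, K) \<in> p" for x K
      proof -
        have "x \<in> K" "K \<subseteq> {a..b}" using p xK by blast+
        moreover obtain u v where K: "K = {u..v}" using p xK by (metis box_real(2) tagged_division_ofD(4))
        ultimately have uv: "a \<le> u" "u \<le> x" "x \<le> v" "v \<le> b" by auto
        have si: "Sup K = v" "Inf K = u" "measure lborel K = v - u" using uv K by auto
        show ?thesis
        proof (cases "x \<in> N")
          case True
          then show ?thesis using lipM[of u v] uv c(1)
            by (simp add: si h_def norm_minus_commute add_increasing)
        next
          case False
          have "u \<in> ball x (d x)" "v \<in> ball x (d x)"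
            using fineD[OF fd xK] uv K by (auto simp del: mem_ball)
          then have 1: "norm (f u - f x - (u-x) *\<^sub>R f' x) \<le> c * norm (u-x)"
             and 2: "norm (f v - f x - (v-x) *\<^sub>R f' x) \<le> c * norm (v-x)"
            using d(2)[of x u] d(2)[of x v] False uv by (auto simp: dist_norm norm_minus_commute)
          have "(v - u) *\<^sub>R f' x - (f v - f u) = (f u - f x - (u-x) *\<^sub>R f' x) - (f v - f x - (v-x) *\<^sub>R f' x)"
            by (simp add: algebra_simps)
          then have "norm ((v - u) *\<^sub>R f' x - (f v - f u)) \<le> c * norm (u-x) + c * norm (v-x)"
            by (simp only:) (rule order_trans[OF norm_triangle_ineq4 add_mono[OF 1 2]])
          also have "\<dots> = c * (v - u)" using uv by (simp add: algebra_simps)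
          finally show ?thesis using False by (simp add: si h_def)
        qed
      qed
      have sums: "f b - f a = (\<Sum>(x,K)\<in>p. f (Sup K) - f (Inf K))" "b - a = (\<Sum>(x,K)\<in>p. Sup K - Inf K)"
        using additive_tagged_division_1[OF ab p, of f] additive_tagged_division_1[OF ab p, of "\<lambda>x. x"] by auto
      have "(\<Sum>(x,K)\<in>p. measure lborel K *\<^sub>R h x) - (f b - f a)
          = (\<Sum>(x,K)\<in>p. measure lborel K *\<^sub>R h x - (f (Sup K) - f (Inf K)))"
        unfolding sums by (simp add: sum_subtractf case_prod_unfold)
      then have "norm ((\<Sum>(x,K)\<in>p. measure lborel K *\<^sub>R h x) - (f b - f a))
          \<le> (\<Sum>(x,K)\<in>p. c * (Sup K - Inf K) + M * (measure lborel K *\<^sub>R indicat_real N x))"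
        using * by (auto intro!: sum_norm_le)
      also have "\<dots> = c * (b - a) + M * (\<Sum>(x,K)\<in>p. measure lborel K *\<^sub>R indicat_real N x)"
        unfolding sums by (simp add: sum.distrib sum_distrib_left case_prod_unfold)
      also have "\<dots> < e / 2 + M * (e / (2 * M))"
        using \<gamma>_sum[OF p fg] c(2) M by (intro add_strict_mono mult_strict_left_mono) auto
      also have "\<dots> = e" using M by simp
      finally show "norm ((\<Sum>(x,K)\<in>p. measure lborel K *\<^sub>R h x) - (f b - f a)) < e" .
    qed
  qed
  then show ?thesis
    by (rule has_integral_spike[OF N, rotated]) (auto simp: h_def)
qed

lemma AE_lebesgue_iff_negligible: "(AE x in lebesgue. P x) \<longleftrightarrow> negligible {x. \<not> P x}"
proof -
  have "(AE x in lebesgue. P x) \<longleftrightarrow> (\<exists>N. negligible N \<and> {x. \<not> P x} \<subseteq> N)"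
    by (auto simp: eventually_ae_filter negligible_iff_null_sets)
  then show ?thesis by (meson negligible_subset order_refl)
qed

text \<open>The differential equation is given almost everywhere only. Since \<open>y'\<close> is locally Lipschitz, it is the
  integral of the right-hand side; where that is continuous, the equation holds at every point, at
  the ends of the interval one-sidedly.\<close>

lemma W2inf_loc_deriv_C1:
  assumes W: "W2inf_loc y" and ab: "a \<le> b"
    and ode: "AE s in lebesgue. s \<in> {a<..<b} \<longrightarrow> (deriv1 y has_vector_derivative f s) (at s)"
    and f: "continuous_on {a..b} f"
    and s: "s \<in> {a..b}"
  shows "(deriv1 y has_vector_derivative f s) (at s within {a..b})"
proof -
  obtain g where g: "Linf_loc g" "\<And>a b. a \<le> b \<Longrightarrow> (g has_integral (deriv1 y b - deriv1 y a)) {a..b}"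
    using W unfolding W2inf_loc_def by blast
  obtain C where "AE s in lebesgue. s \<in> {a..b} \<longrightarrow> norm (g s) \<le> C"
    using g(1) unfolding Linf_loc_def by blast
  then have N1: "negligible {s. \<not> (s \<in> {a..b} \<longrightarrow> norm (g s) \<le> C)}" (is "negligible ?N1")
    by (simp add: AE_lebesgue_iff_negligible)
  have lip: "norm (deriv1 y v - deriv1 y u) \<le> \<bar>C\<bar> * (v - u)" if "a \<le> u" "u \<le> v" "v \<le> b" for u v
  proof -
    have "((\<lambda>s. if s \<in> ?N1 then 0 else g s) has_integral (deriv1 y v - deriv1 y u)) (cbox u v)"
      unfolding box_real by (rule has_integral_spike[OF N1 _ g(2)[OF that(2)]]) (auto simp: that)
    then have "norm (deriv1 y v - deriv1 y u) \<le> \<bar>C\<bar> * measure lborel (cbox u v)"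
      by (rule has_integral_bound[rotated]) (use that in auto)
    then show ?thesis using that by simp
  qed
  have N2: "negligible ({s. \<not> (s \<in> {a<..<b} \<longrightarrow> (deriv1 y has_vector_derivative f s) (at s))} \<union> {a,b})"
    using ode[unfolded AE_lebesgue_iff_negligible] by (rule negligible_Un) (simp add: negligible_finite)
  have int: "(f has_integral (deriv1 y t - deriv1 y a)) {a..t}" if t: "t \<in> {a..b}" for t
  proof (rule lipschitz_AE_derivative_has_integral[OF _ N2, where C="\<bar>C\<bar>"])
    show "(deriv1 y has_vector_derivative f x) (at x within {a..t})"
      if "x \<in> {a..t} - ({s. \<not> (s \<in> {a<..<b} \<longrightarrow> (deriv1 y has_vector_derivative f s) (at s))} \<union> {a,b})" for x
      by (rule has_vector_derivative_at_within) (use that t in auto)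
  qed (use t lip in auto)
  have eq: "deriv1 y t = deriv1 y a + integral {a..t} f" if "t \<in> {a..b}" for t
    using int[OF that] by (simp add: integral_unique)
  have "((\<lambda>t. deriv1 y a + integral {a..t} f) has_vector_derivative f s) (at s within {a..b})"
    using integral_has_vector_derivative[OF f s] by (auto intro!: derivative_eq_intros)
  then show ?thesis
    by (rule has_vector_derivative_transform[OF s _ , rotated]) (rule eq)
qed

section \<open>Solutions of the harmonic equation\<close>

text \<open>The functions \<open>(V \<plusminus> i k y) exp (\<mp> i k s)\<close> are constant, so \<open>y\<close> is a combination of the two
  exponentials. The hypothesis on the data at \<open>s0\<close> says that both coefficients are nonzero; this is
  what allows a finite phase \<open>\<zeta>\<close>.\<close>

lemma harmonic_eq_sin:
  fixes y V :: "real \<Rightarrow> complex"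
  assumes k: "k \<noteq> 0" and s0: "s0 \<in> {a..b}"
    and y: "\<And>s. s \<in> {a..b} \<Longrightarrow> (y has_vector_derivative V s) (at s within {a..b})"
    and V: "\<And>s. s \<in> {a..b} \<Longrightarrow> (V has_vector_derivative - (k\<^sup>2 * y s)) (at s within {a..b})"
    and ne: "(k * y s0)\<^sup>2 + (V s0)\<^sup>2 \<noteq> 0"
  obtains D \<zeta> where "D \<noteq> 0"
    and "\<And>s. s \<in> {a..b} \<Longrightarrow> y s = D * sin (\<zeta> + k * of_real (s - s0))"
    and "\<And>s. s \<in> {a..b} \<Longrightarrow> V s = D * k * cos (\<zeta> + k * of_real (s - s0))"
proof -
  have const: "(V s + \<sigma> * k * y s) * exp (- (\<sigma> * k * of_real (s - s0))) = V s0 + \<sigma> * k * y s0"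
    if \<sigma>: "\<sigma>\<^sup>2 = -1" and s: "s \<in> {a..b}" for \<sigma> s
  proof -
    let ?P = "\<lambda>s. (V s + \<sigma> * k * y s) * exp (- (\<sigma> * k * of_real (s - s0)))"
    have \<sigma>2: "\<sigma> * \<sigma> = -1" using \<sigma> by (simp add: power2_eq_square)
    have P: "(?P has_vector_derivative 0) (at s within {a..b})" if "s \<in> {a..b}" for s
    proof -
      have "((\<lambda>s. exp (- (\<sigma> * k * of_real (s - s0)))) has_vector_derivative
           - (\<sigma> * k) * exp (- (\<sigma> * k * of_real (s - s0)))) (at s within {a..b})"
        unfolding of_real_diff
      proof (rule has_vector_derivative_real_field)
        show "((\<lambda>z. exp (- (\<sigma> * k * (z - of_real s0)))) has_field_derivative
           - (\<sigma> * k) * exp (- (\<sigma> * k * (of_real s - of_real s0)))) (at (of_real s))"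
          by (auto intro!: derivative_eq_intros)
      qed
      note E = this[folded of_real_diff]
      have "(?P has_vector_derivative (V s + \<sigma> * k * y s) * (- (\<sigma> * k) * exp (- (\<sigma> * k * of_real (s - s0))))
         + (- (k\<^sup>2 * y s) + \<sigma> * k * V s) * exp (- (\<sigma> * k * of_real (s - s0)))) (at s within {a..b})"
        by (intro has_vector_derivative_mult has_vector_derivative_add has_vector_derivative_mult_right
              V y E that)
      moreover have "(V s + \<sigma> * k * y s) * (- (\<sigma> * k) * exp (- (\<sigma> * k * of_real (s - s0))))
         + (- (k\<^sup>2 * y s) + \<sigma> * k * V s) * exp (- (\<sigma> * k * of_real (s - s0)))
         = - (\<sigma> * \<sigma> + 1) * k\<^sup>2 * y s * exp (- (\<sigma> * k * of_real (s - s0)))"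
        by (simp add: algebra_simps power2_eq_square)
      ultimately show ?thesis by (simp add: \<sigma>2)
    qed
    obtain c where "\<And>x. x \<in> {a..b} \<Longrightarrow> ?P x = c"
      by (rule has_vector_derivative_zero_constant[of "{a..b}" ?P]) (use P in auto)
    then have "?P s = ?P s0" using s s0 by blast
    then show ?thesis by simp
  qed
  define u v where "u = k * y s0" and "v = V s0"
  have fac: "(v + \<i> * u) * (v - \<i> * u) = u\<^sup>2 + v\<^sup>2"
    by (simp add: algebra_simps power2_eq_square)
  then have nz: "v + \<i> * u \<noteq> 0" "v - \<i> * u \<noteq> 0" using ne by (auto simp: u_def v_def)
  \<comment> \<open>\<open>D\<close> and \<open>\<zeta>\<close> solve \<open>D k exp (\<plusminus> i \<zeta>) = v \<plusminus> i u\<close>.\<close>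
  define \<zeta> where "\<zeta> = Ln ((v + \<i> * u) / (v - \<i> * u)) / (2 * \<i>)"
  define D where "D = (v + \<i> * u) * exp (- (\<i> * \<zeta>)) / k"
  have "exp (\<i> * \<zeta>) * exp (\<i> * \<zeta>) = exp (Ln ((v + \<i> * u) / (v - \<i> * u)))"
    by (simp add: \<zeta>_def flip: exp_add)
  then have e2: "exp (\<i> * \<zeta>) * exp (\<i> * \<zeta>) = (v + \<i> * u) / (v - \<i> * u)" using nz by simp
  have D1: "D * k * exp (\<i> * \<zeta>) = v + \<i> * u" using k by (simp add: D_def exp_minus)
  have "D * k * exp (- (\<i> * \<zeta>)) = (v + \<i> * u) / (exp (\<i> * \<zeta>) * exp (\<i> * \<zeta>))"
    using k by (simp add: D_def exp_minus divide_simps)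
  then have D2: "D * k * exp (- (\<i> * \<zeta>)) = v - \<i> * u" unfolding e2 using nz by simp
  have move: "X = Y * exp w" if "X * exp (- w) = Y" for X Y w :: complex
    using that by (auto simp: exp_minus)
  have sol: "V s + \<i> * k * y s = D * k * exp (\<i> * (\<zeta> + k * of_real (s - s0)))"
            "V s - \<i> * k * y s = D * k * exp (- (\<i> * (\<zeta> + k * of_real (s - s0))))" if s: "s \<in> {a..b}" for s
  proof -
    have "V s + \<i> * k * y s = D * k * exp (\<i> * \<zeta>) * exp (\<i> * k * of_real (s - s0))"
      unfolding D1 u_def v_def mult.assoc[symmetric] by (rule move, rule const[OF _ s]) simp
    then show "V s + \<i> * k * y s = D * k * exp (\<i> * (\<zeta> + k * of_real (s - s0)))"
      by (simp only: exp_add distrib_left mult.assoc)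
    have "V s + (- \<i>) * k * y s = (V s0 + (- \<i>) * k * y s0) * exp ((- \<i>) * k * of_real (s - s0))"
      by (rule move, rule const[OF _ s]) simp
    also have "V s0 + (- \<i>) * k * y s0 = D * k * exp (- (\<i> * \<zeta>))"
      unfolding D2 u_def v_def by simp
    finally show "V s - \<i> * k * y s = D * k * exp (- (\<i> * (\<zeta> + k * of_real (s - s0))))"
      by (simp only: exp_add distrib_left mult.assoc minus_add_distrib mult_minus_left) simp
  qed
  show thesis
  proof
    show "D \<noteq> 0" using D1 nz by auto
    fix s assume s: "s \<in> {a..b}"
    let ?z = "\<zeta> + k * of_real (s - s0)"
    have "2 * V s = D * k * (exp (\<i> * ?z) + exp (- (\<i> * ?z)))"
      unfolding distrib_left[of "D * k"] sol[OF s, symmetric] by simp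
    then have "2 * V s = 2 * (D * k * cos ?z)" by (simp add: cos_exp_eq)
    then show "V s = D * k * cos ?z" by simp
    have "2 * \<i> * k * y s = D * k * (exp (\<i> * ?z) - exp (- (\<i> * ?z)))"
      unfolding right_diff_distrib[of "D * k"] sol[OF s, symmetric] by simp
    also have "exp (\<i> * ?z) - exp (- (\<i> * ?z)) = 2 * \<i> * sin ?z" by (simp add: sin_exp_eq)
    finally have "2 * \<i> * k * y s = 2 * \<i> * k * (D * sin ?z)" by (simp only: mult_ac)
    then show "y s = D * sin ?z" using k by simp
  qed
qed

text \<open>Formally \<open>(sin (k h) / k)\<^sup>2 = h\<^sup>2 - k\<^sup>2 h\<^sup>4 / 3 + \<dots>\<close>, so the sign comes from the second term.
  Instead of expanding, the proof uses that \<open>f h = sin (k h) / k\<close> satisfies \<open>f'' = - k\<^sup>2 f\<close> and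
  \<open>f h \<approx> h\<close>: for small \<open>h > 0\<close> this makes \<open>Im f''\<close>, then \<open>Im f'\<close>, then \<open>Im f\<close> positive.
  Negative \<open>h\<close> follow because \<open>f\<close> is odd.\<close>

lemma Im_sin_quotient_square_pos:
  assumes k: "Im (k\<^sup>2) < 0"
  shows "\<forall>\<^sub>F h in at (0::real). Im ((sin (k * of_real h) / k)\<^sup>2) > 0"
proof -
  have k0: "k \<noteq> 0" using k by auto
  define f :: "real \<Rightarrow> complex" where "f h = sin (k * of_real h) / k" for h
  define f' :: "real \<Rightarrow> complex" where "f' h = cos (k * of_real h)" for h
  have df: "(f has_vector_derivative f' h) (at h)" for h
    unfolding f_def f'_def
    by (rule has_vector_derivative_real_field) (use k0 in \<open>auto intro!: derivative_eq_intros\<close>)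
  have df': "(f' has_vector_derivative - (k\<^sup>2 * f h)) (at h)" for h
    unfolding f_def f'_def
    by (rule has_vector_derivative_real_field)
       (use k0 in \<open>auto intro!: derivative_eq_intros simp: power2_eq_square\<close>)
  have f0: "f 0 = 0" "f' 0 = 1" by (auto simp: f_def f'_def)
  have "((\<lambda>z. sin (k * z) / k) has_field_derivative 1) (at 0)"
    using k0 by (auto intro!: derivative_eq_intros)
  then have "((\<lambda>z. sin (k * z) / k / z) \<longlongrightarrow> 1) (at 0)"
    using k0 by (simp add: DERIV_def)
  moreover have "filterlim complex_of_real (at 0) (at 0)"
    by (intro filterlim_atI) (auto intro!: tendsto_eq_intros simp: eventually_at_filter)
  ultimately have lim: "((\<lambda>h. f h / of_real h) \<longlongrightarrow> 1) (at 0)"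
    unfolding f_def by (rule filterlim_compose)
  have "\<forall>\<^sub>F h in at 0. Re (f h / of_real h) > 0"
    using lim by (intro order_tendstoD(1)[OF tendsto_Re[OF lim]]) auto
  moreover have "((\<lambda>h. k\<^sup>2 * (f h / of_real h)) \<longlongrightarrow> k\<^sup>2 * 1) (at 0)"
    by (intro tendsto_intros lim)
  then have "\<forall>\<^sub>F h in at 0. Im (k\<^sup>2 * (f h / of_real h)) < 0"
    using k by (intro order_tendstoD(2)[OF tendsto_Im]) auto
  ultimately have "\<forall>\<^sub>F h in at 0. Re (f h / of_real h) > 0 \<and> Im (k\<^sup>2 * (f h / of_real h)) < 0"
    by eventually_elim auto
  then obtain d where d: "d > 0"
    and R': "\<And>h. h \<noteq> 0 \<Longrightarrow> \<bar>h\<bar> < d \<Longrightarrow> Re (f h / of_real h) > 0"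
    and I': "\<And>h. h \<noteq> 0 \<Longrightarrow> \<bar>h\<bar> < d \<Longrightarrow> Im (k\<^sup>2 * (f h / of_real h)) < 0"
    unfolding eventually_at by (auto simp: dist_real_def)
  have R: "Re (f h) > 0" and I: "Im (k\<^sup>2 * f h) < 0" if h: "0 < h" "h < d" for h
  proof -
    have "Re (f h) / h > 0" "Im (k\<^sup>2 * f h) / h < 0"
      using R'[of h] I'[of h] h unfolding times_divide_eq_right Re_divide_of_real Im_divide_of_real by auto
    then show "Re (f h) > 0" "Im (k\<^sup>2 * f h) < 0"
      using h by (simp_all only: zero_less_divide_iff divide_less_0_iff) auto
  qed
  have If': "Im (f' h) > 0" if "0 < h" "h < d" for h
  proof -
    have "Im (f' 0) < Im (f' h)"
    proof (rule DERIV_pos_imp_increasing_open[OF that(1)])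
      show "\<exists>y. ((\<lambda>h. Im (f' h)) has_real_derivative y) (at t) \<and> y > 0" if "0 < t" "t < h" for t

        using I[of t] that \<open>h < d\<close> has_field_derivative_Im[OF df'[of t]]
        by (intro exI[of _ "Im (- (k\<^sup>2 * f t))"] conjI) (simp_all only: uminus_complex.sel, simp)
      show "continuous_on {0..h} (\<lambda>h. Im (f' h))"
        unfolding f'_def by (intro continuous_intros)
    qed
    then show ?thesis by (simp add: f0)
  qed
  have If: "Im (f h) > 0" if "0 < h" "h < d" for h
  proof -
    have "Im (f 0) < Im (f h)"
    proof (rule DERIV_pos_imp_increasing_open[OF that(1)])
      show "\<exists>y. ((\<lambda>h. Im (f h)) has_real_derivative y) (at t) \<and> y > 0" if "0 < t" "t < h" for t

        using If'[of t] that \<open>h < d\<close> has_field_derivative_Im[OF df[of t]]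
        by (intro exI[of _ "Im (f' t)"] conjI) auto
      show "continuous_on {0..h} (\<lambda>h. Im (f h))"
        unfolding f_def using k0 by (intro continuous_intros) auto
    qed
    then show ?thesis by (simp add: f0)
  qed
  have "Im ((f h)\<^sup>2) > 0" if "h \<noteq> 0" "\<bar>h\<bar> < d" for h
  proof (cases "h > 0")
    case True
    then show ?thesis using R[of h] If[of h] that by (simp add: power2_eq_square)
  next
    case False
    have "f h = - f (- h)" by (simp add: f_def)
    then show ?thesis using False R[of "-h"] If[of "-h"] that by (simp add: power2_eq_square mult_pos_pos)
  qed
  then show ?thesis using d unfolding eventually_at f_def by (auto simp: dist_real_def)
qed

section \<open>The complex sine along a line\<close>

lemma Re_Im_sin_cos_Complex:
  "Re (sin (Complex p q)) = sin p * cosh q" "Im (sin (Complex p q)) = cos p * sinh q"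
  "Re (cos (Complex p q)) = cos p * cosh q" "Im (cos (Complex p q)) = - sin p * sinh q"
  by (simp_all add: Re_sin Im_sin Re_cos Im_cos cosh_def sinh_def exp_minus divide_simps)
     (simp add: algebra_simps)

text \<open>With \<open>y = D sin \<zeta>\<close> the quotient \<open>x = y' / (i \<kappa> y)\<close> is \<open>n cos \<zeta> / (i sin \<zeta>)\<close>. These formulas
  translate the quadrant of \<open>x\<close> into the sign of \<open>Im \<zeta>\<close> and the quadrant of \<open>Re \<zeta>\<close>.\<close>

lemma Re_Im_cot_quotient:
  fixes z :: complex and n :: real
  assumes "sin z \<noteq> 0"
  shows "Re (of_real n * cos z / (\<i> * sin z)) = - n * sinh (2 * Im z) / (2 * (cmod (sin z))\<^sup>2)"
    and "Im (of_real n * cos z / (\<i> * sin z)) = - n * sin (2 * Re z) / (2 * (cmod (sin z))\<^sup>2)"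
proof -
  obtain p q where z: "z = Complex p q" by (cases z)
  note form = Re_Im_sin_cos_Complex[of p q, folded z]
  have "of_real n * cos z / (\<i> * sin z) = of_real n * (- \<i>) * (cos z * cnj (sin z)) / (sin z * cnj (sin z))"
    using assms by (simp add: field_simps)
  also have "sin z * cnj (sin z) = of_real ((cmod (sin z))\<^sup>2)"
    by (rule complex_norm_square[symmetric])
  finally have eq: "of_real n * cos z / (\<i> * sin z)
      = of_real n * (- \<i>) * (cos z * cnj (sin z)) / of_real ((cmod (sin z))\<^sup>2)" .
  have "Im (cos z * cnj (sin z)) = - ((sin p)\<^sup>2 + (cos p)\<^sup>2) * (sinh q * cosh q)"
    unfolding times_complex.sel cnj.sel form by algebra
  then have I: "Im (cos z * cnj (sin z)) = - (sinh q * cosh q)" by simp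
  have "Re (cos z * cnj (sin z)) = sin p * cos p * ((cosh q)\<^sup>2 - (sinh q)\<^sup>2)"
    unfolding times_complex.sel cnj.sel form by algebra
  then have R: "Re (cos z * cnj (sin z)) = sin p * cos p" by (simp add: hyperbolic_pythagoras)
  show "Re (of_real n * cos z / (\<i> * sin z)) = - n * sinh (2 * Im z) / (2 * (cmod (sin z))\<^sup>2)"
    unfolding eq Re_divide_of_real using I by (simp add: z sinh_double)
  show "Im (of_real n * cos z / (\<i> * sin z)) = - n * sin (2 * Re z) / (2 * (cmod (sin z))\<^sup>2)"
    unfolding eq Im_divide_of_real using R by (simp add: z sin_double)
qed

text \<open>Taking real and imaginary parts gives \<open>sin p1 cosh q1 = \<tau> cos p0 \<bar>sinh q0\<bar>\<close> and
  \<open>cos p1 \<bar>sinh q1\<bar> = - \<tau> sin p0 cosh q0\<close>. Hence \<open>sin p1 cos p1\<close> and \<open>sin p0 cos p0\<close> have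
  opposite signs, and \<open>cos (p1 - p0)\<close> is \<open>sin p0 cos p0\<close> times a factor that is negative because
  \<open>cosh\<close> exceeds \<open>\<bar>sinh\<bar>\<close>.\<close>

lemma quarter_turn_trig:
  fixes p0 p1 q0 q1 \<tau> :: real
  assumes eq: "sin (Complex p1 q1) = \<i> * of_real \<tau> * sin (Complex p0 q0)"
    and \<tau>: "\<tau> > 0" and q: "q0 < 0" "q1 < 0" and ne: "sin (2 * p0) \<noteq> 0"
  shows "sin (2 * p1) * sin (2 * p0) < 0" and "cos (p1 - p0) * sin (2 * p0) < 0"
proof -
  define S0 C0 S1 C1 where d: "S0 = sin p0" "C0 = cos p0" "S1 = sin p1" "C1 = cos p1"
  define A0 B0 A1 B1 where h: "A0 = cosh q0" "B0 = - sinh q0" "A1 = cosh q1" "B1 = - sinh q1"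
  have pos: "A0 > 0" "B0 > 0" "A1 > 0" "B1 > 0" using q by (auto simp: h)
  have gt: "A0 > B0" "A1 > B1"
    using cosh_plus_sinh[of q0] cosh_plus_sinh[of q1] exp_gt_zero[of q0] exp_gt_zero[of q1]
    unfolding h by linarith+
  have 1: "S1 * A1 = \<tau> * (C0 * B0)" "C1 * B1 = - \<tau> * (S0 * A0)"
    using arg_cong[OF eq, of Re] arg_cong[OF eq, of Im]
    by (auto simp: Re_Im_sin_cos_Complex d h algebra_simps)
  have nz: "S0 \<noteq> 0" "C0 \<noteq> 0" using ne by (auto simp: sin_double d)
  have S1: "S1 = \<tau> * (C0 * B0) / A1" and C1: "C1 = - \<tau> * (S0 * A0) / B1"
    using 1 pos by (auto simp: field_simps)
  have sq: "(S0 * C0)\<^sup>2 > 0" using nz by simp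
  have "sin (2 * p1) * sin (2 * p0) = 4 * (S1 * C1) * (S0 * C0)" by (simp add: sin_double d)
  also have "\<dots> = - 4 * (\<tau>\<^sup>2 * (A0 * B0) / (A1 * B1)) * (S0 * C0)\<^sup>2"
    unfolding S1 C1 using pos by (simp add: field_simps power2_eq_square)
  also have "\<dots> < 0" using pos \<tau> sq by (simp add: mult_pos_pos divide_pos_pos zero_less_mult_iff)
  finally show "sin (2 * p1) * sin (2 * p0) < 0" .
  have "B0 * B1 < A0 * A1" using pos gt by (intro mult_strict_mono) auto
  then have br: "A0 / B1 - B0 / A1 > 0" using pos by (simp add: field_simps)
  have "cos (p1 - p0) * sin (2 * p0) = 2 * (C1 * C0 + S1 * S0) * (S0 * C0)"
    by (simp add: cos_diff sin_double d)
  also have "\<dots> = - 2 * \<tau> * (A0 / B1 - B0 / A1) * (S0 * C0)\<^sup>2"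
    unfolding S1 C1 using pos by (simp add: field_simps power2_eq_square)
  also have "\<dots> < 0" using \<tau> sq br by (simp add: zero_less_mult_iff)
  finally show "cos (p1 - p0) * sin (2 * p0) < 0" .
qed

text \<open>The end points alone determine \<open>p b - p a\<close> only modulo \<open>2\<pi>\<close>. The condition \<open>Re r \<ge> 0\<close> along the
  path fixes the multiple: where \<open>p\<close> had advanced by \<open>\<pi>\<close>, both coordinates of \<open>sin \<zeta>\<close> would
  have changed sign and \<open>Re r\<close> would be negative.\<close>

lemma sin_path_quarter_turn:
  fixes p q :: "real \<Rightarrow> real" and r :: "real \<Rightarrow> complex"
  assumes ab: "a < b" and p: "continuous_on {a..b} p" "p a < p b"
    and q: "\<And>t. t \<in> {a..b} \<Longrightarrow> q t < 0"
    and r: "\<And>t. t \<in> {a..b} \<Longrightarrow> sin (Complex (p t) (q t)) = r t * sin (Complex (p a) (q a))"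
    and Re: "\<And>t. t \<in> {a..b} \<Longrightarrow> Re (r t) \<ge> 0"
    and rb: "Re (r b) = 0" "Im (r b) > 0" and ne: "sin (2 * p a) \<noteq> 0"
  shows "sin (2 * p b) * sin (2 * p a) < 0"
    and "p b - p a < pi"
    and "sin (2 * p a) < 0 \<Longrightarrow> p b - p a < pi / 2"
    and "sin (2 * p a) > 0 \<Longrightarrow> p b - p a > pi / 2"
proof -
  have ends: "a \<in> {a..b}" "b \<in> {a..b}" using ab by auto
  have "r b = \<i> * of_real (Im (r b))" using rb by (simp add: complex_eq_iff)
  then have eq: "sin (Complex (p b) (q b)) = \<i> * of_real (Im (r b)) * sin (Complex (p a) (q a))"
    using r[OF ends(2)] by simp
  note trig = quarter_turn_trig[OF eq rb(2) q[OF ends(1)] q[OF ends(2)] ne]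
  show "sin (2 * p b) * sin (2 * p a) < 0" by (rule trig)
  show lt: "p b - p a < pi"
  proof (rule ccontr)
    assume "\<not> p b - p a < pi"
    then have "p a \<le> p a + pi" "p a + pi \<le> p b" by auto
    then obtain t where t: "a \<le> t" "t \<le> b" "p t = p a + pi"
      using IVT'[of p a "p a + pi" b] p ab by auto
    have tin: "t \<in> {a..b}" using t by auto
    let ?s = "sin (Complex (p a) (q a))"
    have "Re (r t) * (cmod ?s)\<^sup>2 = Re (r t * ?s * cnj ?s)"
      by (simp add: mult.assoc complex_norm_square[symmetric] del: of_real_power)
    also have "\<dots> = Re (sin (Complex (p t) (q t)) * cnj ?s)" by (simp add: r[OF tin])
    also have "\<dots> = - ((sin (p a))\<^sup>2 * (cosh (q t) * cosh (q a)) + (cos (p a))\<^sup>2 * (sinh (q t) * sinh (q a)))"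
      by (simp add: Re_Im_sin_cos_Complex t(3) power2_eq_square algebra_simps)
    also have "\<dots> < 0"
    proof -
      have "sinh (q t) * sinh (q a) > 0" using q[OF tin] q[OF ends(1)] by (simp add: mult_neg_neg)
      moreover have "cosh (q t) * cosh (q a) > 0" by (simp add: cosh_real_pos)
      moreover have "sin (p a) \<noteq> 0" using ne by (auto simp: sin_double)
      ultimately have "(sin (p a))\<^sup>2 * (cosh (q t) * cosh (q a)) > 0"
        "(cos (p a))\<^sup>2 * (sinh (q t) * sinh (q a)) \<ge> 0" by simp_all
      then show ?thesis by linarith
    qed
    finally have "Re (r t) < 0" by (simp add: mult_less_0_iff)
    then show False using Re[OF tin] by simp
  qed
  show "p b - p a < pi / 2" if "sin (2 * p a) < 0"
  proof (rule ccontr)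
    assume "\<not> ?thesis"
    then have "cos (p b - p a) \<le> cos (pi / 2)" using lt by (intro cos_monotone_0_pi_le) auto
    then show False using trig(2) that by (simp add: mult_less_0_iff)
  qed
  show "p b - p a > pi / 2" if "sin (2 * p a) > 0"
  proof (rule ccontr)
    assume "\<not> ?thesis"
    then have "cos (pi / 2) \<le> cos (p b - p a)" using p(2) by (intro cos_monotone_0_pi_le) auto
    then show False using trig(2) that by (simp add: mult_less_0_iff)
  qed
qed

section \<open>Plane curves turning between the coordinate axes\<close>

text \<open>A curve that starts at \<open>1\<close>, rotates counterclockwise and avoids both axes stays in the open first
  quadrant: \<open>Re r\<close> cannot vanish, and the slope \<open>Im r / Re r\<close> increases from \<open>0\<close>. If it ends
  on one of the axes, that cannot be the real axis, because the slope is then already bounded away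
  from \<open>0\<close>.\<close>

lemma real_endpoints_quarter_turn:
  fixes r r' :: "real \<Rightarrow> complex"
  assumes ab: "a < b" and cont: "continuous_on {a..b} r" and ra: "r a = 1"
    and der: "\<And>t. t \<in> {a<..<b} \<Longrightarrow> (r has_vector_derivative r' t) (at t)"
    and rot: "\<And>t. t \<in> {a<..<b} \<Longrightarrow> Im (r' t * cnj (r t)) > 0"
    and sq: "\<And>t. t \<in> {a<..<b} \<Longrightarrow> Im ((r t)\<^sup>2) \<noteq> 0"
    and rb: "Im ((r b)\<^sup>2) = 0" "r b \<noteq> 0"
  shows "t \<in> {a..b} \<Longrightarrow> Re (r t) \<ge> 0" and "Re (r b) = 0" and "Im (r b) > 0"
proof -
  have cR: "continuous_on {a..b} (\<lambda>t. Re (r t))" and cI: "continuous_on {a..b} (\<lambda>t. Im (r t))"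
    using cont by (auto intro!: continuous_intros)
  have sub: "continuous_on {u..v} f" if "continuous_on {a..b} f" "a \<le> u" "v \<le> b" for u v and f :: "real \<Rightarrow> real"
    using that by (auto intro: continuous_on_subset)
  have nz: "Re (r t) \<noteq> 0" if "t \<in> {a<..<b}" for t
    using sq[OF that] by (auto simp: power2_eq_square)
  have no_zero: False if t: "Re (r t) \<le> 0" "a \<le> t" "t < b \<or> Re (r t) < 0" "t \<le> b" for t
  proof -
    obtain u where u: "a \<le> u" "u \<le> t" "Re (r u) = 0"
      using IVT2'[of "\<lambda>t. Re (r t)" t 0 a, OF t(1) _ t(2) sub[OF cR order_refl t(4)]]
      by (auto simp: ra)
    then have "u \<noteq> a" "u \<noteq> b" using ra t by auto
    then show False using nz[of u] u t by auto
  qed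
  have pos: "Re (r t) > 0" if "t \<in> {a..<b}" for t
    using no_zero[of t] that by force
  show nonneg: "Re (r t) \<ge> 0" if "t \<in> {a..b}" for t
    using no_zero[of t] that by force
  define T where "T t = Im (r t) / Re (r t)" for t
  have incr: "T u < T v" if "a \<le> u" "u < v" "v < b" for u v
  proof (rule DERIV_pos_imp_increasing_open[OF that(2)])
    show "continuous_on {u..v} T" unfolding T_def
    proof (intro continuous_on_divide sub[OF cR] sub[OF cI] ballI)
      fix t assume "t \<in> {u..v}"
      then show "Re (r t) \<noteq> 0" using pos[of t] that by auto
    qed (use that in auto)
    fix t assume t: "u < t" "t < v"
    then have tin: "t \<in> {a<..<b}" using that by auto
    have R: "((\<lambda>t. Re (r t)) has_real_derivative Re (r' t)) (at t)"
      and I: "((\<lambda>t. Im (r t)) has_real_derivative Im (r' t)) (at t)"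
      using der[OF tin] by (auto intro!: has_field_derivative_Re has_field_derivative_Im)
    have "(T has_real_derivative (Im (r' t) * Re (r t) - Im (r t) * Re (r' t)) / (Re (r t) * Re (r t))) (at t)"
      unfolding T_def by (rule DERIV_divide[OF I R nz[OF tin]])
    moreover have "(Im (r' t) * Re (r t) - Im (r t) * Re (r' t)) / (Re (r t) * Re (r t)) > 0"
      using rot[OF tin] nz[OF tin] by (intro divide_pos_pos) (auto simp: algebra_simps zero_less_mult_iff)
    ultimately show "\<exists>d. (T has_real_derivative d) (at t) \<and> d > 0" by blast
  qed
  \<comment> \<open>From the midpoint on, the curve lies above the line of slope \<open>T m > 0\<close>; by continuity \<open>r b\<close>
    does not lie below it.\<close>
  define m where "m = (a + b) / 2"
  have m: "a < m" "m < b" using ab by (auto simp: m_def)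
  have Tm: "T m > 0" using incr[of a m] m by (simp add: T_def ra)
  define G where "G t = Im (r t) - T m * Re (r t)" for t
  have Gpos: "G t > 0" if "m < t" "t < b" for t
    using incr[of m t] pos[of t] that m by (simp add: T_def G_def field_simps)
  have Gb: "G b \<ge> 0"
  proof (rule ccontr)
    define m' where "m' = (m + b) / 2"
    have m': "m < m'" "m' < b" using m by (auto simp: m'_def)
    assume "\<not> G b \<ge> 0"
    moreover have "continuous_on {m'..b} G" unfolding G_def
      using m m' by (intro continuous_intros sub[OF cI] sub[OF cR]) auto
    ultimately obtain u where u: "m' \<le> u" "u \<le> b" "G u = 0"
      using IVT2'[of G b 0 m'] Gpos[of m'] m' by force
    then have "u < b" using \<open>\<not> G b \<ge> 0\<close> by (cases "u = b") auto
    then show False using Gpos[of u] u m' by auto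
  qed
  have prod: "Re (r b) * Im (r b) = 0" using rb(1) by (auto simp: power2_eq_square)
  show Re0: "Re (r b) = 0"
  proof (rule ccontr)
    assume "Re (r b) \<noteq> 0"
    then have "T m * Re (r b) > 0" "Im (r b) = 0" using nonneg[of b] ab Tm prod by auto
    then show False using Gb by (simp add: G_def)
  qed
  show "Im (r b) > 0"
    using Gb rb(2) Re0 by (simp add: G_def complex_eq_iff)
qed

section \<open>The sectors\<close>

text \<open>Multiplication by \<open>\<kappa>\<close> rotates clockwise by \<open>\<theta> = - Arg \<kappa> \<in> (0, \<pi>/2)\<close>. The six sets are what
  remains of the two open half planes \<open>Re z > 0\<close> and \<open>Re z < 0\<close> when the points that this rotation
  carries to the other closed half plane are removed.\<close>

lemma Re_same_sign_in_sectors: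
  assumes \<kappa>: "Re \<kappa> > 0" "Im \<kappa> < 0"
    and z: "z \<in> Sec6 \<kappa> \<union> R_plus \<union> Sec1 \<union> Sec3 \<kappa> \<union> R_minus \<union> Sec4"
  shows "Re z * Re (\<kappa> * z) > 0"
proof -
  define \<theta> where "\<theta> = - Arg \<kappa>"
  have \<kappa>eq: "\<kappa> = of_real (cmod \<kappa>) * exp (\<i> * of_real (- \<theta>))"
    using Arg_eq[of \<kappa>] \<kappa> by (force simp: \<theta>_def)
  have nk: "cmod \<kappa> > 0" using \<kappa> by auto
  have \<theta>: "0 < \<theta>" "\<theta> < pi / 2"
    using \<kappa> Arg_neg_iff[of \<kappa>] Arg_Re_pos[of \<kappa>] by (auto simp: \<theta>_def)
  have main: "Re z * Re (\<kappa> * z) > 0"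
    if "z = of_real c * exp (\<i> * of_real \<xi>)" "c > 0" "cos \<xi> * cos (\<xi> - \<theta>) > 0" for c \<xi>
  proof -
    have "\<kappa> * z = of_real (cmod \<kappa> * c) * exp (\<i> * of_real (\<xi> - \<theta>))"
      by (subst \<kappa>eq, subst that(1)) (simp add: algebra_simps exp_add exp_minus exp_diff divide_simps)
    then have "Re (\<kappa> * z) = cmod \<kappa> * c * cos (\<xi> - \<theta>)" by (simp only: Re_complex_of_real times_complex.sel Im_complex_of_real) (simp add: Re_exp)
    moreover have "Re z = c * cos \<xi>" using that(1) by (simp add: Re_exp)
    ultimately have "Re z * Re (\<kappa> * z) = cmod \<kappa> * c\<^sup>2 * (cos \<xi> * cos (\<xi> - \<theta>))"
      by (simp add: power2_eq_square)
    then show ?thesis using that nk by simp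
  qed
  have per: "cos (t - 2 * pi) = cos t" for t :: real
    using cos_periodic[of "t - 2 * pi"] by simp
  have anti: "cos t = - cos (t - pi)" for t :: real
    using cos_periodic_pi[of "t - pi"] by simp
  have posc: "cos t > 0" if "- (pi/2) < t" "t < pi / 2" for t :: real
    using cos_gt_zero_pi that by auto
  from z consider "z \<in> Sec6 \<kappa>" | "z \<in> R_plus" | "z \<in> Sec1" | "z \<in> Sec3 \<kappa>" | "z \<in> R_minus" | "z \<in> Sec4"
    by blast
  then show ?thesis
  proof cases
    case 1
    then obtain c \<xi> where c: "z = of_real c * exp (\<i> * of_real \<xi>)" "c > 0" "3*pi/2 + \<theta> < \<xi>" "\<xi> < 2 * pi"
      by (auto simp: Sec6_def Sec_def \<theta>_def)
    have "cos (\<xi> - 2 * pi) > 0" "cos (\<xi> - \<theta> - 2 * pi) > 0" using c \<theta> by (intro posc; simp)+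
    then show ?thesis using main[OF c(1,2)] unfolding per by simp
  next
    case 2
    then have "Re z > 0" "Im z = 0" by (auto simp: R_plus_def)
    then show ?thesis using \<kappa> by simp
  next
    case 3
    then obtain c \<xi> where c: "z = of_real c * exp (\<i> * of_real \<xi>)" "c > 0" "0 < \<xi>" "\<xi> < pi/2"
      by (auto simp: Sec1_def Sec_def)
    have "cos \<xi> > 0" "cos (\<xi> - \<theta>) > 0" using c \<theta> by (intro posc; simp)+
    then show ?thesis using main[OF c(1,2)] by simp
  next
    case 4
    then obtain c \<xi> where c: "z = of_real c * exp (\<i> * of_real \<xi>)" "c > 0" "pi/2 + \<theta> < \<xi>" "\<xi> < pi"
      by (auto simp: Sec3_def Sec_def \<theta>_def)
    have "cos (\<xi> - pi) > 0" "cos (\<xi> - \<theta> - pi) > 0" using c \<theta> by (intro posc; simp)+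
    then have "cos \<xi> < 0" "cos (\<xi> - \<theta>) < 0"
      using anti[of \<xi>] anti[of "\<xi> - \<theta>"] by linarith+
    then show ?thesis by (intro main[OF c(1,2)] mult_neg_neg)
  next
    case 5
    then have "Re z < 0" "Im z = 0" by (auto simp: R_minus_def)
    then show ?thesis using \<kappa> by (simp add: mult_neg_neg mult_pos_neg)
  next
    case 6
    then obtain c \<xi> where c: "z = of_real c * exp (\<i> * of_real \<xi>)" "c > 0" "pi < \<xi>" "\<xi> < 3*pi/2"
      by (auto simp: Sec4_def Sec_def)
    have "cos (\<xi> - pi) > 0" "cos (\<xi> - \<theta> - pi) > 0" using c \<theta> by (intro posc; simp)+
    then have "cos \<xi> < 0" "cos (\<xi> - \<theta>) < 0"
      using anti[of \<xi>] anti[of "\<xi> - \<theta>"] by linarith+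
    then show ?thesis by (intro main[OF c(1,2)] mult_neg_neg)
  qed
qed

section \<open>Switch points of a normal extremal tuple\<close>

text \<open>A finite set is closed and discrete, so a limit of values in it is eventually attained. This
  turns the one-sided limits in the definition of a switch point into constancy of \<open>\<epsilon>\<close> nearby.\<close>

lemma two_valued_tendsto_imp_eventually_eq:
  fixes f :: "'a \<Rightarrow> 'b::t1_space"
  assumes "(f \<longlongrightarrow> l) F" and "\<And>t. f t \<in> {u, v}"
  shows "\<forall>\<^sub>F t in F. f t = l"
proof -
  have "closed ({u, v} - {l})" by (intro finite_imp_closed) auto
  then have "\<forall>\<^sub>F t in F. f t \<in> - ({u, v} - {l})"
    by (intro topological_tendstoD[OF assms(1)] open_Compl) auto
  then show ?thesis by (rule eventually_mono) (use assms(2) in blast)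
qed

locale normal_extremal =
  fixes n1 n2 :: real and \<kappa> :: complex and y :: "real \<Rightarrow> complex"
  assumes n: "0 < n1" "n1 < n2" and \<kappa>: "Re \<kappa> > 0" "Im \<kappa> < 0"
    and sol: "solves_nonlinear_eq n1 n2 \<kappa> y"
    and conserved: "Im (of_real (permittivity n1 n2 y s) * (y s)\<^sup>2 + (deriv1 y s)\<^sup>2 / \<kappa>\<^sup>2) = 1"
begin

abbreviation eps :: "real \<Rightarrow> real" where "eps \<equiv> permittivity n1 n2 y"

lemma y_deriv: "(y has_vector_derivative deriv1 y s) (at s)"
  using sol by (simp add: solves_nonlinear_eq_def W2inf_loc_def vector_derivative_works)

lemma y_isCont: "isCont y s"
  using y_deriv by (rule has_vector_derivative_continuous)

lemma y_continuous_on: "continuous_on A y"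
  using y_isCont by (simp add: continuous_at_imp_continuous_on)

lemma eps_eq: "eps s = (if Im ((y s)\<^sup>2) > 0 then n2\<^sup>2 else n1\<^sup>2)"
  by (simp add: permittivity_def C_plus_def)

lemma kappa_nz: "\<kappa> \<noteq> 0" using \<kappa> by auto

lemma n_sq_less: "n1\<^sup>2 < n2\<^sup>2" using n by (simp add: power_strict_mono)

lemma Im_kappa_sq: "Im (\<kappa>\<^sup>2) < 0"
  using \<kappa> by (simp add: power2_eq_square mult_pos_neg mult_neg_pos)

text \<open>One-sided limits do not see the value at the point itself, so \<open>\<epsilon>\<close> has to be constant on a
  punctured neighbourhood only.\<close>

lemma not_switch_point:
  assumes "\<forall>\<^sub>F t in at s. eps t = c"
  shows "\<not> switch_point eps s"
proof
  assume "switch_point eps s"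
  then obtain l r where lr: "(eps \<longlongrightarrow> l) (at_left s)" "(eps \<longlongrightarrow> r) (at_right s)" "l \<noteq> r"
    unfolding switch_point_def by blast
  have "(eps \<longlongrightarrow> c) (at_left s)" "(eps \<longlongrightarrow> c) (at_right s)"
    using assms unfolding eventually_at_split by (auto intro: tendsto_eventually)
  then have "l = c" "r = c" using lr(1,2) by (auto intro: tendsto_unique[rotated])
  then show False using lr(3) by simp
qed

lemma switch_point_Im_sq_zero:
  assumes "switch_point eps s"
  shows "Im ((y s)\<^sup>2) = 0"
proof (rule ccontr)
  let ?g = "\<lambda>t. Im ((y t)\<^sup>2)"
  assume ne: "?g s \<noteq> 0"
  have lim: "(?g \<longlongrightarrow> ?g s) (at s)"
    using y_isCont[of s] unfolding isCont_def by (intro tendsto_intros)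
  have "\<exists>c. \<forall>\<^sub>F t in at s. eps t = c"
  proof (cases "?g s > 0")
    case True
    then have "\<forall>\<^sub>F t in at s. ?g t > 0" using lim by (rule order_tendstoD(1)[rotated])
    then have "\<forall>\<^sub>F t in at s. eps t = n2\<^sup>2" by eventually_elim (simp add: eps_eq)
    then show ?thesis ..
  next
    case False
    then have "\<forall>\<^sub>F t in at s. ?g t < 0" using lim ne by (intro order_tendstoD(2)) auto
    then have "\<forall>\<^sub>F t in at s. eps t = n1\<^sup>2" by eventually_elim (simp add: eps_eq)
    then show ?thesis ..
  qed
  then show False using assms not_switch_point by blast
qed

lemma Im_deriv_sq:
  assumes "Im ((y s)\<^sup>2) = 0"
  shows "Im ((deriv1 y s)\<^sup>2 / \<kappa>\<^sup>2) = 1"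
proof -
  have "Im (of_real (eps s) * (y s)\<^sup>2) = 0" using assms by simp
  then show ?thesis using conserved[of s] unfolding plus_complex.sel by linarith
qed

text \<open>The derivative of \<open>Im y\<^sup>2\<close> is \<open>2 Im (y\<^sup>2 (y'/y))\<close>, which is \<open>2 y\<^sup>2 Im (y'/y) \<noteq> 0\<close> where \<open>y\<^sup>2\<close> is
  real and nonzero. So \<open>Im y\<^sup>2\<close> changes sign there and \<open>\<epsilon>\<close> jumps.\<close>

lemma transversal_imp_switch_point:
  assumes g0: "Im ((y s)\<^sup>2) = 0" and y0: "y s \<noteq> 0" and tr: "Im (deriv1 y s / y s) \<noteq> 0"
  shows "switch_point eps s"
proof -
  let ?g = "\<lambda>t. Im ((y t)\<^sup>2)"
  define g' where "g' = Im (2 * y s * deriv1 y s)"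
  have ysq: "(y s)\<^sup>2 = of_real (Re ((y s)\<^sup>2))" using g0 by (simp add: complex_eq_iff)
  then have "Re ((y s)\<^sup>2) \<noteq> 0" using y0 by (metis of_real_0 zero_eq_power2)
  moreover have "2 * y s * deriv1 y s = of_real 2 * ((y s)\<^sup>2 * (deriv1 y s / y s))"
    using y0 by (simp add: power2_eq_square)
  then have "g' = 2 * (Re ((y s)\<^sup>2) * Im (deriv1 y s / y s))"
    unfolding g'_def by (subst (asm) ysq) (simp only: times_complex.sel Re_complex_of_real Im_complex_of_real, simp)
  ultimately have g': "g' \<noteq> 0" using tr by simp
  have "((\<lambda>t. y t * y t) has_vector_derivative (y s * deriv1 y s + deriv1 y s * y s)) (at s)"
    by (intro has_vector_derivative_mult y_deriv)
  then have "(?g has_real_derivative g') (at s)"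
    unfolding power2_eq_square g'_def
    by (intro has_field_derivative_Im) (simp add: algebra_simps)
  then have lim: "((\<lambda>t. (?g t - ?g s) / (t - s)) \<longlongrightarrow> g') (at s)"
    by (simp add: has_field_derivative_iff)
  then have lim: "((\<lambda>t. ?g t / (t - s)) \<longlongrightarrow> g') (at s)"
    by (simp only: g0 diff_zero)
  have side: "\<forall>\<^sub>F t in at_left s. t < s" "\<forall>\<^sub>F t in at_right s. t > s"
    by (auto simp: eventually_at_filter)
  have splitL: "\<forall>\<^sub>F t in at_left s. P t" and splitR: "\<forall>\<^sub>F t in at_right s. P t"
    if "\<forall>\<^sub>F t in at s. P t" for P using that unfolding eventually_at_split by auto
  show ?thesis
  proof (cases "g' > 0")
    case True
    then have ev: "\<forall>\<^sub>F t in at s. ?g t / (t - s) > 0" using lim by (rule order_tendstoD(1)[rotated])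
    have "\<forall>\<^sub>F t in at_left s. eps t = n1\<^sup>2"
      using splitL[OF ev] side(1) by eventually_elim (auto simp: eps_eq zero_less_divide_iff)
    moreover have "\<forall>\<^sub>F t in at_right s. eps t = n2\<^sup>2"
      using splitR[OF ev] side(2) by eventually_elim (auto simp: eps_eq zero_less_divide_iff)
    ultimately show ?thesis unfolding switch_point_def using n_sq_less
      by (intro exI[of _ "n1\<^sup>2"] exI[of _ "n2\<^sup>2"]) (auto intro: tendsto_eventually)
  next
    case False
    then have ev: "\<forall>\<^sub>F t in at s. ?g t / (t - s) < 0" using lim g' by (intro order_tendstoD(2)) auto
    have "\<forall>\<^sub>F t in at_left s. eps t = n2\<^sup>2"
      using splitL[OF ev] side(1) by eventually_elim (auto simp: eps_eq divide_less_0_iff)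
    moreover have "\<forall>\<^sub>F t in at_right s. eps t = n1\<^sup>2"
      using splitR[OF ev] side(2) by eventually_elim (auto simp: eps_eq divide_less_0_iff)
    ultimately show ?thesis unfolding switch_point_def using n_sq_less
      by (intro exI[of _ "n2\<^sup>2"] exI[of _ "n1\<^sup>2"]) (auto intro: tendsto_eventually)
  qed
qed

text \<open>Where \<open>y\<^sup>2\<close> is real, the conserved quantity is \<open>Im (y'\<^sup>2 / \<kappa>\<^sup>2) = 1\<close> whatever the value of
  \<open>\<epsilon>\<close>. Hence \<open>e y\<^sup>2 + y'\<^sup>2 / \<kappa>\<^sup>2 \<noteq> 0\<close> also at an end point of the interval, where \<open>\<epsilon>\<close> need not
  be \<open>e\<close>, and neither exponential is missing from \<open>y\<close>.\<close>

lemma sin_solution_on_constant_piece: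
  assumes ab: "a < b" and const: "\<And>t. t \<in> {a<..<b} \<Longrightarrow> eps t = e"
    and s: "s \<in> {a..b}" and Im_s: "Im ((y s)\<^sup>2) = 0"
  obtains D \<zeta> where "D \<noteq> 0"
    and "\<And>t. t \<in> {a..b} \<Longrightarrow> y t = D * sin (\<zeta> + of_real (sqrt e) * \<kappa> * of_real (t - s))"
    and "\<And>t. t \<in> {a..b} \<Longrightarrow> deriv1 y t
           = D * (of_real (sqrt e) * \<kappa>) * cos (\<zeta> + of_real (sqrt e) * \<kappa> * of_real (t - s))"
proof -
  let ?k = "of_real (sqrt e) * \<kappa>"
  have "eps ((a + b) / 2) = e" using ab by (intro const) auto
  then have e: "e > 0" using n by (auto simp: eps_eq split: if_splits)
  have k: "?k \<noteq> 0" using e kappa_nz by simp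
  have ksq: "?k\<^sup>2 = \<kappa>\<^sup>2 * of_real e"
    using e by (simp add: power_mult_distrib mult.commute flip: of_real_power)
  have V: "(deriv1 y has_vector_derivative - (?k\<^sup>2 * y t)) (at t within {a..b})" if t: "t \<in> {a..b}" for t
  proof (rule W2inf_loc_deriv_C1[OF _ less_imp_le[OF ab] _ _ t])
    show "W2inf_loc y" using sol by (simp add: solves_nonlinear_eq_def)
    show "continuous_on {a..b} (\<lambda>t. - (?k\<^sup>2 * y t))"
      by (intro continuous_intros y_continuous_on)
    have "AE t in lebesgue. (deriv1 y has_vector_derivative - (\<kappa>\<^sup>2 * y t * of_real (eps t))) (at t)"
      using sol by (simp add: solves_nonlinear_eq_def)
    moreover have "- (\<kappa>\<^sup>2 * y t * of_real e) = - (?k\<^sup>2 * y t)" for t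
      by (simp only: ksq) (simp only: mult_ac)
    ultimately show "AE t in lebesgue. t \<in> {a<..<b} \<longrightarrow> (deriv1 y has_vector_derivative - (?k\<^sup>2 * y t)) (at t)"
      by (elim eventually_mono) (metis const)
  qed
  have "Im (of_real e * (y s)\<^sup>2) = 0" using Im_s by simp
  then have "Im (of_real e * (y s)\<^sup>2 + (deriv1 y s)\<^sup>2 / \<kappa>\<^sup>2) = 1"
    using Im_deriv_sq[OF Im_s] unfolding plus_complex.sel by linarith
  then have "of_real e * (y s)\<^sup>2 + (deriv1 y s)\<^sup>2 / \<kappa>\<^sup>2 \<noteq> 0" by (metis zero_complex.sel(2) zero_neq_one)
  then have "\<kappa>\<^sup>2 * (of_real e * (y s)\<^sup>2 + (deriv1 y s)\<^sup>2 / \<kappa>\<^sup>2) \<noteq> 0" using kappa_nz by simp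
  then have ne: "(?k * y s)\<^sup>2 + (deriv1 y s)\<^sup>2 \<noteq> 0"
    unfolding power_mult_distrib[of ?k] ksq using kappa_nz by (simp add: distrib_left mult.assoc)
  have y: "(y has_vector_derivative deriv1 y t) (at t within {a..b})" for t
    by (rule has_vector_derivative_at_within[OF y_deriv])
  show thesis by (rule harmonic_eq_sin[OF k s y V ne]) (use that in auto)
qed

text \<open>At a zero the conserved quantity is \<open>Im (y'\<^sup>2 / \<kappa>\<^sup>2) = 1\<close>. If \<open>y'\<^sup>2\<close> is real there, it must be
  positive since \<open>Im \<kappa>\<^sup>2 < 0\<close>, and \<open>y\<^sup>2\<close> is this positive number times \<open>(sin (k h) / k)\<^sup>2\<close>. The lemma
  applies to either side of the zero, whatever the constant value of \<open>\<epsilon>\<close> on that side is.\<close>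

lemma zero_with_real_slope_Im_sq_pos:
  assumes ab: "a < b" and const: "\<And>t. t \<in> {a<..<b} \<Longrightarrow> eps t = e"
    and s: "s \<in> {a..b}" and ys: "y s = 0" and slope: "Im ((deriv1 y s)\<^sup>2) = 0"
  shows "\<forall>\<^sub>F t in at s within {a..b}. Im ((y t)\<^sup>2) > 0"
proof -
  let ?k = "of_real (sqrt e) * \<kappa>" and ?c = "deriv1 y s"
  have "eps ((a + b) / 2) = e" using ab by (intro const) auto
  then have e: "e > 0" using n by (auto simp: eps_eq split: if_splits)
  have k: "?k \<noteq> 0" using e kappa_nz by simp
  have ksq: "?k\<^sup>2 = of_real e * \<kappa>\<^sup>2"
    using e by (simp add: power_mult_distrib flip: of_real_power)
  have Imk: "Im (?k\<^sup>2) < 0"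
    unfolding ksq times_complex.sel using e Im_kappa_sq by (simp add: mult_pos_neg)
  obtain D \<zeta> where D: "D \<noteq> 0"
    and sol_y: "\<And>t. t \<in> {a..b} \<Longrightarrow> y t = D * sin (\<zeta> + ?k * of_real (t - s))"
    and sol_V: "\<And>t. t \<in> {a..b} \<Longrightarrow> deriv1 y t = D * ?k * cos (\<zeta> + ?k * of_real (t - s))"
    by (rule sin_solution_on_constant_piece[OF ab const s]) (use ys in auto)
  have z: "sin \<zeta> = 0" using sol_y[OF s] ys D by simp
  have c: "?c = D * ?k * cos \<zeta>" using sol_V[OF s] by simp
  have y_eq: "y t = ?c * (sin (?k * of_real (t - s)) / ?k)" if "t \<in> {a..b}" for t
    unfolding sol_y[OF that] sin_add z c using k by (simp add: field_simps)
  define \<rho> where "\<rho> = Re (?c\<^sup>2)"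
  have csq: "?c\<^sup>2 = of_real \<rho>" using slope by (simp add: complex_eq_iff \<rho>_def)
  have one: "Im (of_real \<rho> / \<kappa>\<^sup>2) = 1" using Im_deriv_sq[of s] ys by (simp add: csq)
  have "of_real \<rho> / \<kappa>\<^sup>2 = of_real \<rho> * cnj (\<kappa>\<^sup>2) / of_real ((cmod (\<kappa>\<^sup>2))\<^sup>2)"
    using complex_norm_square[of "\<kappa>\<^sup>2"] kappa_nz by (simp add: field_simps)
  then have "1 = - \<rho> * Im (\<kappa>\<^sup>2) / (cmod (\<kappa>\<^sup>2))\<^sup>2"
    using one unfolding \<open>of_real \<rho> / \<kappa>\<^sup>2 = _\<close> Im_divide_of_real times_complex.sel cnj.sel by simp
  then have \<rho>: "\<rho> > 0" using Im_kappa_sq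
    by (smt (verit) divide_nonpos_nonneg mult_nonneg_nonpos2 mult_minus_left mult_nonpos_nonpos zero_le_power2)
  obtain d where d: "d > 0" and pos: "\<And>h. h \<noteq> 0 \<Longrightarrow> \<bar>h\<bar> < d \<Longrightarrow> Im ((sin (?k * of_real h) / ?k)\<^sup>2) > 0"
    using Im_sin_quotient_square_pos[OF Imk] unfolding eventually_at by (auto simp: dist_real_def)
  have "Im ((y t)\<^sup>2) > 0" if "t \<in> {a..b}" "t \<noteq> s" "\<bar>t - s\<bar> < d" for t
  proof -
    have "(y t)\<^sup>2 = of_real \<rho> * (sin (?k * of_real (t - s)) / ?k)\<^sup>2"
      unfolding y_eq[OF that(1)] power_mult_distrib csq ..
    then have "Im ((y t)\<^sup>2) = \<rho> * Im ((sin (?k * of_real (t - s)) / ?k)\<^sup>2)"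
      by (simp only: times_complex.sel Im_complex_of_real Re_complex_of_real)
    then show ?thesis using pos[of "t - s"] that \<rho> by simp
  qed
  then show ?thesis using d unfolding eventually_at by (auto simp: dist_real_def)
qed

text \<open>Near a zero \<open>y\<^sup>2\<close> is to leading order \<open>y'(s)\<^sup>2 (t - s)\<^sup>2\<close>, an even function of \<open>t - s\<close>. If
  \<open>y'(s)\<^sup>2\<close> is not real, \<open>Im y\<^sup>2\<close> has the same sign on both sides. If it is real, the next order
  decides, and it makes \<open>Im y\<^sup>2\<close> positive on both sides.\<close>

lemma switch_point_nonzero:
  assumes sw: "switch_point eps s"
  shows "y s \<noteq> 0"
proof
  assume ys: "y s = 0"
  obtain l r where lr: "(eps \<longlongrightarrow> l) (at_left s)" "(eps \<longlongrightarrow> r) (at_right s)" "l \<noteq> r"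
    using sw unfolding switch_point_def by blast
  let ?c = "deriv1 y s"
  show False
  proof (cases "Im (?c\<^sup>2) = 0")
    case True
    have two: "eps t \<in> {n1\<^sup>2, n2\<^sup>2}" for t by (simp add: eps_eq)
    have evl: "\<forall>\<^sub>F t in at_left s. eps t = l" and evr: "\<forall>\<^sub>F t in at_right s. eps t = r"
      using two_valued_tendsto_imp_eventually_eq[OF lr(1) two]
            two_valued_tendsto_imp_eventually_eq[OF lr(2) two] by auto
    obtain a where a: "a < s" "\<And>t. t \<in> {a<..<s} \<Longrightarrow> eps t = l"
      using evl unfolding eventually_at_left_field by auto
    obtain b where b: "s < b" "\<And>t. t \<in> {s<..<b} \<Longrightarrow> eps t = r"
      using evr unfolding eventually_at_right_field by auto
    have "\<forall>\<^sub>F t in at_left s. Im ((y t)\<^sup>2) > 0"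
      using zero_with_real_slope_Im_sq_pos[OF a(1) a(2) _ ys True] a(1)
      by (simp add: at_within_Icc_at_left)
    then have "\<forall>\<^sub>F t in at_left s. l = n2\<^sup>2"
      using evl by eventually_elim (simp add: eps_eq)
    moreover have "\<forall>\<^sub>F t in at_right s. Im ((y t)\<^sup>2) > 0"
      using zero_with_real_slope_Im_sq_pos[OF b(1) b(2) _ ys True] b(1)
      by (simp add: at_within_Icc_at_right)
    then have "\<forall>\<^sub>F t in at_right s. r = n2\<^sup>2"
      using evr by eventually_elim (simp add: eps_eq)
    ultimately show False using lr(3) by simp
  next
    case False
    have "((\<lambda>t. (Re (y t) - Re (y s)) / (t - s)) \<longlongrightarrow> Re ?c) (at s)"
         "((\<lambda>t. (Im (y t) - Im (y s)) / (t - s)) \<longlongrightarrow> Im ?c) (at s)"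
      using has_field_derivative_Re[OF y_deriv[of s]] has_field_derivative_Im[OF y_deriv[of s]]
      by (simp_all only: has_field_derivative_iff)
    then have "((\<lambda>t. 2 * (Re (y t) / (t - s)) * (Im (y t) / (t - s))) \<longlongrightarrow> 2 * Re ?c * Im ?c) (at s)"
      unfolding ys by (intro tendsto_intros) simp_all
    then have lim: "((\<lambda>t. Im ((y t)\<^sup>2) / (t - s)\<^sup>2) \<longlongrightarrow> Im (?c\<^sup>2)) (at s)"
      by (simp add: Im_power2 power2_eq_square mult_ac)
    have "\<exists>c. \<forall>\<^sub>F t in at s. eps t = c"
    proof (cases "Im (?c\<^sup>2) > 0")
      case True
      then have "\<forall>\<^sub>F t in at s. Im ((y t)\<^sup>2) / (t - s)\<^sup>2 > 0" using lim by (rule order_tendstoD(1)[rotated])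
      then have "\<forall>\<^sub>F t in at s. eps t = n2\<^sup>2"
        by eventually_elim (auto simp: eps_eq zero_less_divide_iff)
      then show ?thesis ..
    next
      case F: False
      then have "\<forall>\<^sub>F t in at s. Im ((y t)\<^sup>2) / (t - s)\<^sup>2 < 0" using lim False by (intro order_tendstoD(2)) auto
      then have "\<forall>\<^sub>F t in at s. eps t = n1\<^sup>2"
        by eventually_elim (auto simp: eps_eq divide_less_0_iff)
      then show ?thesis ..
    qed
    then show False using not_switch_point sw by blast
  qed
qed

section \<open>A single layer\<close>

text \<open>In a layer \<open>Im y\<^sup>2\<close> can only vanish at points that would be switch points, so it keeps its sign,
  and \<open>\<epsilon>\<close> equals \<open>e\<close> at every point of the open layer.\<close>

lemma layer_constant:
  assumes ab: "a < b" and ns: "\<And>t. t \<in> {a<..<b} \<Longrightarrow> \<not> switch_point eps t"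
    and reg: "\<And>t. t \<in> {a<..<b} \<Longrightarrow> y t \<noteq> 0 \<and> Im (deriv1 y t / y t) \<noteq> 0"
    and e: "(eps \<longlongrightarrow> e) (at_right a)" and t: "t \<in> {a<..<b}"
  shows "Im ((y t)\<^sup>2) \<noteq> 0" and "eps t = e"
proof -
  let ?g = "\<lambda>t. Im ((y t)\<^sup>2)"
  have nz: "?g t \<noteq> 0" if "t \<in> {a<..<b}" for t
    using transversal_imp_switch_point[of t] ns[OF that] reg[OF that] by blast
  show "?g t \<noteq> 0" by (rule nz[OF t])
  have conn: "connected (?g ` {a<..<b})"
    by (intro connected_continuous_image continuous_intros y_continuous_on) auto
  have same: "?g u > 0 \<longleftrightarrow> ?g t > 0" if u: "u \<in> {a<..<b}" for u
  proof (rule ccontr)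
    assume "\<not> ?thesis"
    then have "\<exists>v w. v \<in> ?g ` {a<..<b} \<and> w \<in> ?g ` {a<..<b} \<and> v \<le> 0 \<and> 0 \<le> w"
      using u t by (metis image_eqI linorder_not_less order_less_imp_le)
    then have "0 \<in> ?g ` {a<..<b}" using connectedD_interval[OF conn] by blast
    then show False using nz by auto
  qed
  have "eps u = eps t" if "u \<in> {a<..<b}" for u
    using same[OF that] by (simp add: eps_eq)
  then have "\<forall>\<^sub>F u in at_right a. eps u = eps t"
    unfolding eventually_at_right_field using ab by auto
  then have "(eps \<longlongrightarrow> eps t) (at_right a)" by (rule tendsto_eventually)
  then show "eps t = e" using e by (rule tendsto_unique[rotated]) simp
qed

text \<open>The increment of \<open>p = Re \<zeta>\<close> over the layer is \<open>\<surd>e Re \<kappa> (b - a)\<close>, and \<open>y / y a\<close> makes a quarter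
  turn, counterclockwise if \<open>X\<close> stays in the right half plane and clockwise if it stays in the left
  one. Comparing the two gives the bounds; the sign of \<open>sin (2 p)\<close> at the ends gives the crossing.\<close>

lemma layer_crossing_and_length:
  assumes ab: "a < b" and ns: "\<And>t. t \<in> {a<..<b} \<Longrightarrow> \<not> switch_point eps t"
    and sw: "switch_point eps a" "switch_point eps b"
    and X: "\<And>t. X t = deriv1 y t / (\<i> * \<kappa> * y t)"
    and reg: "\<And>t. t \<in> {a<..<b} \<Longrightarrow> y t \<noteq> 0 \<and> Re (X t) * Re (\<kappa> * X t) > 0"
    and e: "(eps \<longlongrightarrow> e) (at_right a)"
  shows "Im (X a) * Im (X b) < 0"
    and "Im (X a) > 0 \<Longrightarrow> b - a < pi / (2 * sqrt e * Re \<kappa>)"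
    and "Im (X a) < 0 \<Longrightarrow> pi / (2 * sqrt e * Re \<kappa>) < b - a \<and> b - a < pi / (sqrt e * Re \<kappa>)"
proof -
  have ends: "a \<in> {a..b}" "b \<in> {a..b}" using ab by auto
  have rot: "Im (deriv1 y t / y t) = Re (\<kappa> * X t)" if "y t \<noteq> 0" for t
  proof -
    have "deriv1 y t / y t = \<i> * (\<kappa> * X t)" using that kappa_nz by (simp add: X)
    then show ?thesis by simp
  qed
  have reg': "y t \<noteq> 0 \<and> Im (deriv1 y t / y t) \<noteq> 0" if "t \<in> {a<..<b}" for t
    using reg[OF that] rot[of t] by (auto simp: zero_less_mult_iff)
  have g: "Im ((y t)\<^sup>2) \<noteq> 0" and const: "eps t = e" if "t \<in> {a<..<b}" for t
    using layer_constant[OF ab ns reg' e that] by auto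
  have "eps ((a + b) / 2) = e" using ab by (intro const) auto
  then have epos: "e > 0" using n by (auto simp: eps_eq split: if_splits)
  define m where "m = sqrt e"
  have m: "m > 0" using epos by (simp add: m_def)
  have g_ends: "Im ((y a)\<^sup>2) = 0" "Im ((y b)\<^sup>2) = 0" using sw by (auto intro: switch_point_Im_sq_zero)
  have y_ends: "y a \<noteq> 0" "y b \<noteq> 0" using sw[THEN switch_point_nonzero] by auto
  have ynz: "y t \<noteq> 0" if "t \<in> {a..b}" for t
    using reg[of t] y_ends that by (cases "t = a \<or> t = b") auto
  obtain D \<zeta> where D: "D \<noteq> 0"
    and sol_y: "\<And>t. t \<in> {a..b} \<Longrightarrow> y t = D * sin (\<zeta> + of_real m * \<kappa> * of_real (t - a))"
    and sol_V: "\<And>t. t \<in> {a..b} \<Longrightarrow> deriv1 y t = D * (of_real m * \<kappa>) * cos (\<zeta> + of_real m * \<kappa> * of_real (t - a))"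
    unfolding m_def by (rule sin_solution_on_constant_piece[OF ab const ends(1) g_ends(1)]) auto
  define p q where "p t = Re \<zeta> + m * Re \<kappa> * (t - a)" and "q t = Im \<zeta> + m * Im \<kappa> * (t - a)" for t
  have Z: "\<zeta> + of_real m * \<kappa> * of_real (t - a) = Complex (p t) (q t)" for t
    by (simp add: complex_eq_iff p_def q_def)
  have y_eq: "y t = D * sin (Complex (p t) (q t))" if "t \<in> {a..b}" for t
    using sol_y[OF that] by (simp only: Z)
  have snz: "sin (Complex (p t) (q t)) \<noteq> 0" if "t \<in> {a..b}" for t
    using ynz[OF that] y_eq[OF that] by auto
  have X_eq: "X t = of_real m * cos (Complex (p t) (q t)) / (\<i> * sin (Complex (p t) (q t)))" if "t \<in> {a..b}" for t
    unfolding X sol_V[OF that] y_eq[OF that] Z using D kappa_nz by (simp add: field_simps)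
  have ReX: "Re (X t) = - m * sinh (2 * q t) / (2 * (cmod (sin (Complex (p t) (q t))))\<^sup>2)"
    and ImX: "Im (X t) = - m * sin (2 * p t) / (2 * (cmod (sin (Complex (p t) (q t))))\<^sup>2)"
    if "t \<in> {a..b}" for t
    unfolding X_eq[OF that] using Re_Im_cot_quotient[OF snz[OF that], of m] by simp_all
  have sgnX: "Re (X t) > 0 \<longleftrightarrow> q t < 0" "Re (X t) < 0 \<longleftrightarrow> q t > 0"
    "Im (X t) > 0 \<longleftrightarrow> sin (2 * p t) < 0" "Im (X t) < 0 \<longleftrightarrow> sin (2 * p t) > 0"
    if "t \<in> {a..b}" for t
    using m snz[OF that] unfolding ReX[OF that] ImX[OF that]
    by (auto simp: zero_less_divide_iff divide_less_0_iff zero_less_mult_iff mult_less_0_iff)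
  \<comment> \<open>Where \<open>y\<^sup>2\<close> is real, conservation gives \<open>Im X\<^sup>2 = - 1 / y\<^sup>2\<close>. This puts \<open>X\<close> at the ends
    of the layer, which the sector hypothesis does not reach, off both axes.\<close>
  have offaxes: "Re (X t) \<noteq> 0 \<and> Im (X t) \<noteq> 0" if "Im ((y t)\<^sup>2) = 0" "y t \<noteq> 0" for t
  proof -
    have ysq: "(y t)\<^sup>2 = of_real (Re ((y t)\<^sup>2))" using that by (simp add: complex_eq_iff)
    have "(X t)\<^sup>2 * (y t)\<^sup>2 = - ((deriv1 y t)\<^sup>2 / \<kappa>\<^sup>2)"
      using that(2) kappa_nz by (simp add: X power_divide power_mult_distrib)
    then have "Im ((X t)\<^sup>2 * (y t)\<^sup>2) = - 1" using Im_deriv_sq[OF that(1)] by simp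
    then have "Im ((X t)\<^sup>2) \<noteq> 0" by (subst (asm) ysq) auto
    then show ?thesis by (auto simp: Im_power2)
  qed
  have ne: "sin (2 * p a) \<noteq> 0" using offaxes[OF g_ends(1) y_ends(1)] ImX[OF ends(1)] by auto
  have p: "continuous_on {a..b} p" "p a < p b" and pd: "p b - p a = m * Re \<kappa> * (b - a)"
    unfolding p_def using ab m \<kappa> by (auto intro!: continuous_intros)
  have qnz: "q t \<noteq> 0" if "t \<in> {a..b}" for t
  proof (cases "t = a \<or> t = b")
    case True
    then show ?thesis using offaxes[of t] g_ends y_ends ReX[OF that] by auto
  next
    case False
    then show ?thesis using reg[of t] that ReX[OF that] by auto
  qed
  have conn: "connected (q ` {a..b})"
    unfolding q_def by (intro connected_continuous_image continuous_intros) auto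
  \<comment> \<open>The sign of \<open>q\<close> tells whether \<open>X\<close> moves in the right or in the left sectors.\<close>
  have q_sign: "(\<forall>t\<in>{a..b}. q t < 0) \<or> (\<forall>t\<in>{a..b}. q t > 0)"
  proof (rule ccontr)
    assume "\<not> ?thesis"
    then have "\<exists>v w. v \<in> q ` {a..b} \<and> w \<in> q ` {a..b} \<and> v \<le> 0 \<and> 0 \<le> w"
      by (meson image_eqI linorder_not_less)
    then have "0 \<in> q ` {a..b}" using connectedD_interval[OF conn] by blast
    then show False using qnz by auto
  qed
  define r where "r t = y t / y a" for t
  have r_eq: "sin (Complex (p t) (q t)) = r t * sin (Complex (p a) (q a))" if "t \<in> {a..b}" for t
    using y_eq[OF that] y_eq[OF ends(1)] D snz[OF ends(1)] by (simp add: r_def)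
  define \<rho> where "\<rho> = Re ((y a)\<^sup>2)"
  have yasq: "(y a)\<^sup>2 = of_real \<rho>" using g_ends by (simp add: complex_eq_iff \<rho>_def)
  then have \<rho>: "\<rho> \<noteq> 0" using y_ends by auto
  have Im_rsq: "Im ((r t)\<^sup>2) = Im ((y t)\<^sup>2) / \<rho>" for t
    by (simp only: r_def power_divide yasq Im_divide_of_real)
  have r_cont: "continuous_on {a..b} r" unfolding r_def
    using y_ends by (intro continuous_intros y_continuous_on) auto
  have r_der: "(r has_vector_derivative deriv1 y t / y a) (at t)" for t
    unfolding r_def using y_deriv by (rule has_vector_derivative_divide)
  have ra: "r a = 1" and rb: "r b \<noteq> 0" using y_ends by (auto simp: r_def)
  have r_sq: "Im ((r t)\<^sup>2) \<noteq> 0" if "t \<in> {a<..<b}" for t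
    using g[OF that] \<rho> by (simp add: Im_rsq)
  have rb_sq: "Im ((r b)\<^sup>2) = 0" using g_ends by (simp add: Im_rsq)
  have r_rot: "Im (deriv1 y t / y a * cnj (r t)) = (cmod (r t))\<^sup>2 * Re (\<kappa> * X t)" if "y t \<noteq> 0" for t
  proof -
    have "deriv1 y t / y a * cnj (r t) = (r t * cnj (r t)) * (deriv1 y t / y t)"
      using that by (simp add: r_def)
    also have "\<dots> = of_real ((cmod (r t))\<^sup>2) * (deriv1 y t / y t)"
      by (simp only: complex_norm_square)
    finally show ?thesis using rot[OF that]
      by (simp only: times_complex.sel(2) Re_complex_of_real Im_complex_of_real)
  qed
  have concl: "sin (2 * p b) * sin (2 * p a) < 0" "p b - p a < pi"
      "sin (2 * p a) < 0 \<Longrightarrow> p b - p a < pi / 2"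
      "sin (2 * p a) > 0 \<Longrightarrow> p b - p a > pi / 2"
  proof -
    consider "\<forall>t\<in>{a..b}. q t < 0" | "\<forall>t\<in>{a..b}. q t > 0" using q_sign by blast
    then have "sin (2 * p b) * sin (2 * p a) < 0 \<and> p b - p a < pi
      \<and> (sin (2 * p a) < 0 \<longrightarrow> p b - p a < pi / 2) \<and> (sin (2 * p a) > 0 \<longrightarrow> p b - p a > pi / 2)"
    proof cases
      case 1
      have "Im (deriv1 y t / y a * cnj (r t)) > 0" if t: "t \<in> {a<..<b}" for t
      proof -
        have "Re (X t) > 0" using 1 sgnX(1)[of t] t by auto
        then have "Re (\<kappa> * X t) > 0" using reg[OF t] by (auto simp: zero_less_mult_iff)
        then show ?thesis
          unfolding r_rot[OF conjunct1[OF reg[OF t]]] using reg[OF t] y_ends by (simp add: r_def)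
      qed
      note turn = real_endpoints_quarter_turn[OF ab r_cont ra r_der this r_sq rb_sq rb]
      show ?thesis
        using sin_path_quarter_turn[OF ab p _ r_eq turn ne] 1 by blast
    next
      case 2
      \<comment> \<open>Here \<open>arg y\<close> decreases. Conjugation reverses the rotation and the sign of \<open>q\<close> but keeps \<open>p\<close>.\<close>
      let ?r = "\<lambda>t. cnj (r t)"
      have rot': "Im (cnj (deriv1 y t / y a) * cnj (?r t)) > 0" if t: "t \<in> {a<..<b}" for t
      proof -
        have "Re (X t) < 0" using 2 sgnX(2)[of t] t by auto
        then have "Re (\<kappa> * X t) < 0" using reg[OF t] by (auto simp: zero_less_mult_iff)
        then have "Im (deriv1 y t / y a * cnj (r t)) < 0"
          unfolding r_rot[OF conjunct1[OF reg[OF t]]] using reg[OF t] y_ends by (simp add: r_def mult_pos_neg)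
        moreover have "cnj (deriv1 y t / y a) * cnj (?r t) = cnj (deriv1 y t / y a * cnj (r t))" by simp
        ultimately show ?thesis by (simp only: cnj.sel)
      qed
      have "Im ((?r t)\<^sup>2) = - Im ((r t)\<^sup>2)" for t by (simp add: Im_power2)
      then have sq': "Im ((?r b)\<^sup>2) = 0" "\<And>t. t \<in> {a<..<b} \<Longrightarrow> Im ((?r t)\<^sup>2) \<noteq> 0"
        using r_sq rb_sq by simp_all
      have cont': "continuous_on {a..b} ?r" using r_cont by (rule continuous_on_cnj)
      have ra': "?r a = 1" and rb': "?r b \<noteq> 0" using ra rb by simp_all
      note turn = real_endpoints_quarter_turn[OF ab cont' ra' has_vector_derivative_cnj[OF r_der] rot'
          sq'(2) sq'(1) rb']
      have neg: "- q t < 0" if "t \<in> {a..b}" for t using 2 that by auto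
      have path: "sin (Complex (p t) (- q t)) = ?r t * sin (Complex (p a) (- q a))" if "t \<in> {a..b}" for t
        using arg_cong[OF r_eq[OF that], of cnj] by (simp add: cnj_sin complex_cnj)
      show ?thesis
        using sin_path_quarter_turn[OF ab p neg path turn ne] by blast
    qed
    then show "sin (2 * p b) * sin (2 * p a) < 0" "p b - p a < pi"
      "sin (2 * p a) < 0 \<Longrightarrow> p b - p a < pi / 2"
      "sin (2 * p a) > 0 \<Longrightarrow> p b - p a > pi / 2" by auto
  qed
  have mk: "m * Re \<kappa> > 0" using m \<kappa> by simp
  show "Im (X a) * Im (X b) < 0"
    using concl(1) sgnX(3,4)[OF ends(1)] sgnX(3,4)[OF ends(2)] by (auto simp: mult_less_0_iff)
  have quot: "pi / (2 * sqrt e * Re \<kappa>) = (pi / 2) / (m * Re \<kappa>)" "pi / (sqrt e * Re \<kappa>) = pi / (m * Re \<kappa>)"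
    by (simp_all add: m_def)
  show "b - a < pi / (2 * sqrt e * Re \<kappa>)" if "Im (X a) > 0"
    using concl(3) that unfolding sgnX(3)[OF ends(1)] pd quot pos_less_divide_eq[OF mk] by (simp only: mult.commute)
  show "pi / (2 * sqrt e * Re \<kappa>) < b - a \<and> b - a < pi / (sqrt e * Re \<kappa>)" if "Im (X a) < 0"
    using concl(2,4) that
    unfolding sgnX(4)[OF ends(1)] pd quot pos_less_divide_eq[OF mk] pos_divide_less_eq[OF mk]
    by (simp only: mult.commute)
qed

end

theorem theorem6p9:
  fixes n1 n2 e :: real and \<kappa> :: complex
    and x :: "real \<Rightarrow> complex option" and \<epsilon> :: "real \<Rightarrow> real" and y :: "real \<Rightarrow> complex"
    and b :: "int \<Rightarrow> real" and j :: int
  assumes "0 < n1" and "n1 < n2" and "Re \<kappa> > 0" and "Im \<kappa> < 0"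
    and "extended_extremal_tuple n1 n2 \<kappa> x \<epsilon> 1 y"
    and "switch_sequence \<epsilon> b"
    and "(\<epsilon> \<longlongrightarrow> e) (at_right (b j))"
    and "x ` {b j<..<b (j + 1)} \<subseteq>
           Some ` (Sec6 \<kappa> \<union> R_plus \<union> Sec1 \<union> Sec3 \<kappa> \<union> R_minus \<union> Sec4)"
  shows "(x (b j) \<in> Some ` C_plus \<longrightarrow>
            x (b (j + 1)) \<in> Some ` C_minus \<and>
            b (j + 1) - b j < pi / (2 * sqrt e * Re \<kappa>)) \<and>
         (x (b j) \<in> Some ` C_minus \<longrightarrow>
            x (b (j + 1)) \<in> Some ` C_plus \<and>
            pi / (2 * sqrt e * Re \<kappa>) < b (j + 1) - b j \<and>
            b (j + 1) - b j < pi / (sqrt e * Re \<kappa>))"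
proof -
  have \<epsilon>: "\<epsilon> = permittivity n1 n2 y" and x: "x = log_deriv_x \<kappa> y"
    and ext: "solves_nonlinear_eq n1 n2 \<kappa> y"
      "\<And>s. Im (of_real (permittivity n1 n2 y s) * (y s)\<^sup>2 + (deriv1 y s)\<^sup>2 / \<kappa>\<^sup>2) = 1"
    using assms(5) by (auto simp: extended_extremal_tuple_def)
  interpret normal_extremal n1 n2 \<kappa> y
    using assms(1-4) ext by unfold_locales
  have mono: "strict_mono b" and rng: "range b = {s. switch_point \<epsilon> s}"
    using assms(6) by (auto simp: switch_sequence_def)
  have sw: "switch_point eps (b i)" for i using rng \<epsilon> by auto
  have lt: "b j < b (j + 1)" using mono by (simp add: strict_mono_def)
  have ns: "\<not> switch_point eps t" if t: "t \<in> {b j<..<b (j + 1)}" for t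
  proof
    assume "switch_point eps t"
    then obtain i where i: "t = b i" using rng \<epsilon> by auto
    then have "j < i" "i < j + 1" using t strict_mono_less[OF mono] by auto
    then show False by simp
  qed
  define X where "X t = deriv1 y t / (\<i> * \<kappa> * y t)" for t
  have x_eq: "x t = (if y t = 0 then None else Some (X t))" for t
    by (simp add: x log_deriv_x_def X_def)
  have reg: "y t \<noteq> 0 \<and> Re (X t) * Re (\<kappa> * X t) > 0" if t: "t \<in> {b j<..<b (j + 1)}" for t
  proof -
    have "x t \<in> Some ` (Sec6 \<kappa> \<union> R_plus \<union> Sec1 \<union> Sec3 \<kappa> \<union> R_minus \<union> Sec4)"
      using assms(8) t by blast
    then have "y t \<noteq> 0" "X t \<in> Sec6 \<kappa> \<union> R_plus \<union> Sec1 \<union> Sec3 \<kappa> \<union> R_minus \<union> Sec4"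
      unfolding x_eq by (auto split: if_splits)
    then show ?thesis using Re_same_sign_in_sectors[OF \<kappa>] by blast
  qed
  have x_ends: "x (b i) = Some (X (b i))" for i
    using switch_point_nonzero[OF sw] by (simp add: x_eq)
  note layer = layer_crossing_and_length[OF lt ns sw sw X_def reg assms(7)[unfolded \<epsilon>]]
  show ?thesis
    using layer unfolding x_ends C_plus_def C_minus_def
    by (auto simp: mult_less_0_iff)
qed

end
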